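(* Let $G$ be a countable sofic group and let $(X,G)$ be an expansive dynamical system with the weak specification property and the strong topological Markov property. Assume that $h_\Sigma(X,G) \geq 0$ for some sofic approximation $\Sigma$ of $G$. Then $(X,G)$ is surjunctive, i.e., every injective continuous $G$-equivariant map $f \colon X \to X$ is surjective.
   Context: A dynamical system is a pair $(X,G)$ consisting of a compact metrizable space $X$ equipped with a continuous action of a countable group $G$ (i.e., $G$ acts by homeomorphisms). An endomorphism of $(X,G)$ is a continuous $G$-equivariant map $f \colon X \to X$. $(X,G)$ is surjunctive if every injective endomorphism of $(X,G)$ is surjective. Fix a metric $\rho$ on $X$ compatible with the topology (none of the notions below depends on the choice of $\rho$). Expansive: there is a constant $c>0$ such that for all distinct $x,y\in X$ there exists $g \in G$ with $\rho(gx,gy)>c$. Weak specification property: for any $\varepsilon>0$ there exists a finite symmetric subset $F \subset G$ containing $1_G$ such that: if $(\Omega_i)_{i\in I}$ is any finite family of finite subsets of $G$ with $F\Omega_i \cap \Omega_j = \varnothing$ for all distinct $i,j\in I$, and $(x_i)_{i \in I}$ is any family of points in $X$, then there exists $x\in X$ such that $\rho(sx,sx_i)\le\varepsilon$ for all $i\in I$ and $s\in\Omega_i$. Strong topological Markov property: for any $\varepsilon>0$ there exist $\delta>0$ and a finite subset $F\subset G$ containing $1_G$ such that: given any finite subset $A\subset G$ and $x,y\in X$ with $\rho(sx,sy)\le\delta$ for all $s\in FA\setminus A$, there exists $z\in X$ with $\rho(sz,sx)\le\varepsilon$ for all $s\in FA$ and $\rho(sz,sy)\le\varepsilon$ for all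 $s\in G\setminus A$. Sofic approximations: for a positive integer $d$ write $[d]=\{1,\dots,d\}$, $\mathrm{Sym}(d)$ for the symmetric group of $[d]$, and $\eta_d(\sigma,\sigma') = \frac1d|\{a\in[d]:\sigma(a)\ne\sigma'(a)\}|$ for the normalized Hamming distance on $\mathrm{Sym}(d)$. A sofic approximation of a countable group $G$ is a sequence $\Sigma=(d_j,\sigma_j)_{j\in\mathbb N}$, where $d_j$ is a positive integer and $\sigma_j\colon G\to\mathrm{Sym}(d_j)$ is a map, such that $\lim_{j} d_j=+\infty$; $\lim_{j}\eta_{d_j}(\sigma_j(s)\sigma_j(t),\sigma_j(st))=0$ for all $s,t\in G$; and $\lim_{j}\eta_{d_j}(\sigma_j(s),\sigma_j(t))=1$ for all distinct $s,t\in G$. A countable group is sofic if it admits a sofic approximation. Sofic topological entropy: for $\varphi,\psi\colon[d]\to X$ set $\rho_2(\varphi,\psi)=\big(\frac1d\sum_{a\in[d]}\rho(\varphi(a),\psi(a))^2\big)^{1/2}$ and $\rho_\infty(\varphi,\psi)=\max_{a\in[d]}\rho(\varphi(a),\psi(a))$. For a nonempty finite $F\subset G$, $\delta>0$, and a map $\sigma\colon G\to\mathrm{Sym}(d)$, $s \mapsto \sigma_s$, let $\mathrm{Map}(X,\rho,F,\delta,\sigma)$ be the set of all $\varphi\colon[d]\to X$ such that $\rho_2(\varphi\circ\sigma_s,s\varphi)<\delta$ for all $s\in F$, where $(s\varphi)(a)=s\varphi(a)$. For $\varepsilon>0$ let $N_\varepsilon(\mathrm{Map}(X,\rho,F,\delta,\sigma),\rho_\infty)$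 be the maximal cardinality of a subset of $\mathrm{Map}(X,\rho,F,\delta,\sigma)$ any two distinct elements of which are at $\rho_\infty$-distance $\ge\varepsilon$ (with $\log 0=-\infty$ when $\mathrm{Map}$ is empty). Then $$h_\Sigma(X,G)=\sup_{\varepsilon>0}\ \inf_{F}\ \inf_{\delta>0}\ \limsup_{j\to\infty}\frac1{d_j}\log N_\varepsilon(\mathrm{Map}(X,\rho,F,\delta,\sigma_j),\rho_\infty)\in\{-\infty\}\cup[0,\infty],$$ with $F$ ranging over nonempty finite subsets of $G$. *)

theory Defs
  imports "HOL-Analysis.Analysis" "HOL-Algebra.Group_Action"
begin

section \<open>Dynamical systems\<close>

text \<open>
  The phase space is a compact subset \<open>X\<close> of a metric space, so that \<open>dist\<close> restricted to \<open>X\<close> is the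
  fixed compatible metric \<open>\<rho>\<close>. In the library's \<^locale>\<open>group_action\<close> every
  \<open>\<alpha> g\<close> is a bijection of \<open>X\<close>, extended by \<open>undefined\<close> outside \<open>X\<close>. Continuity
  of all \<open>\<alpha> g\<close>, including that of the inverse of \<open>g\<close>, makes \<open>G\<close> act by homeomorphisms.
\<close>

locale dynamical_system = group_action G X \<alpha>
  for G :: "('g, 'm) monoid_scheme" (structure)
    and X :: "'x :: metric_space set"
    and \<alpha> :: "'g \<Rightarrow> 'x \<Rightarrow> 'x" +
  assumes countable_group: "countable (carrier G)"
    and compact_space: "compact X"
    and continuous_action: "\<And>g. g \<in> carrier G \<Longrightarrow> continuous_on X (\<alpha> g)"

definition endomorphism ::
    "('g, 'm) monoid_scheme \<Rightarrow> 'x :: metric_space set \<Rightarrow> ('g \<Rightarrow> 'x \<Rightarrow> 'x) \<Rightarrow> ('x \<Rightarrow> 'x) \<Rightarrow> bool"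
  where "endomorphism G X \<alpha> f \<longleftrightarrow>
    f \<in> X \<rightarrow> X \<and> continuous_on X f \<and> (\<forall>g\<in>carrier G. \<forall>x\<in>X. f (\<alpha> g x) = \<alpha> g (f x))"

definition surjunctive ::
    "('g, 'm) monoid_scheme \<Rightarrow> 'x :: metric_space set \<Rightarrow> ('g \<Rightarrow> 'x \<Rightarrow> 'x) \<Rightarrow> bool"
  where "surjunctive G X \<alpha> \<longleftrightarrow>
    (\<forall>f. endomorphism G X \<alpha> f \<longrightarrow> inj_on f X \<longrightarrow> f ` X = X)"

definition expansive ::
    "('g, 'm) monoid_scheme \<Rightarrow> 'x :: metric_space set \<Rightarrow> ('g \<Rightarrow> 'x \<Rightarrow> 'x) \<Rightarrow> bool"
  where "expansive G X \<alpha> \<longleftrightarrow>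
    (\<exists>c>0. \<forall>x\<in>X. \<forall>y\<in>X. x \<noteq> y \<longrightarrow> (\<exists>g\<in>carrier G. dist (\<alpha> g x) (\<alpha> g y) > c))"

text \<open>Finite families are indexed, without loss of generality, by finite sets of natural numbers.\<close>

definition weak_specification ::
    "('g, 'm) monoid_scheme \<Rightarrow> 'x :: metric_space set \<Rightarrow> ('g \<Rightarrow> 'x \<Rightarrow> 'x) \<Rightarrow> bool"
  where "weak_specification G X \<alpha> \<longleftrightarrow>
    (\<forall>\<epsilon>>0. \<exists>F. finite F \<and> F \<subseteq> carrier G \<and> set_inv\<^bsub>G\<^esub> F = F \<and> \<one>\<^bsub>G\<^esub> \<in> F \<and>
      (\<forall>(I :: nat set) \<Omega> x.
        finite I \<longrightarrow>
        (\<forall>i\<in>I. finite (\<Omega> i) \<and> \<Omega> i \<subseteq> carrier G) \<longrightarrow>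
        (\<forall>i\<in>I. \<forall>j\<in>I. i \<noteq> j \<longrightarrow> (F <#>\<^bsub>G\<^esub> \<Omega> i) \<inter> \<Omega> j = {}) \<longrightarrow>
        (\<forall>i\<in>I. x i \<in> X) \<longrightarrow>
        (\<exists>z\<in>X. \<forall>i\<in>I. \<forall>s\<in>\<Omega> i. dist (\<alpha> s z) (\<alpha> s (x i)) \<le> \<epsilon>)))"

definition strong_topological_Markov ::
    "('g, 'm) monoid_scheme \<Rightarrow> 'x :: metric_space set \<Rightarrow> ('g \<Rightarrow> 'x \<Rightarrow> 'x) \<Rightarrow> bool"
  where "strong_topological_Markov G X \<alpha> \<longleftrightarrow>
    (\<forall>\<epsilon>>0. \<exists>\<delta>>0. \<exists>F. finite F \<and> F \<subseteq> carrier G \<and> \<one>\<^bsub>G\<^esub> \<in> F \<and>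
      (\<forall>A x y.
        finite A \<longrightarrow> A \<subseteq> carrier G \<longrightarrow> x \<in> X \<longrightarrow> y \<in> X \<longrightarrow>
        (\<forall>s \<in> (F <#>\<^bsub>G\<^esub> A) - A. dist (\<alpha> s x) (\<alpha> s y) \<le> \<delta>) \<longrightarrow>
        (\<exists>z\<in>X. (\<forall>s \<in> F <#>\<^bsub>G\<^esub> A. dist (\<alpha> s z) (\<alpha> s x) \<le> \<epsilon>) \<and>
               (\<forall>s \<in> carrier G - A. dist (\<alpha> s z) (\<alpha> s y) \<le> \<epsilon>))))"


section \<open>Sofic groups\<close>

definition hamming_dist :: "nat \<Rightarrow> (nat \<Rightarrow> nat) \<Rightarrow> (nat \<Rightarrow> nat) \<Rightarrow> real"
  where "hamming_dist d p q = real (card {a \<in> {1..d}. p a \<noteq> q a}) / real d"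

definition sofic_approximation ::
    "('g, 'm) monoid_scheme \<Rightarrow> (nat \<Rightarrow> nat) \<Rightarrow> (nat \<Rightarrow> 'g \<Rightarrow> nat \<Rightarrow> nat) \<Rightarrow> bool"
  where "sofic_approximation G d \<sigma> \<longleftrightarrow>
    (\<forall>j. d j > 0) \<and>
    (\<forall>j. \<forall>s\<in>carrier G. \<sigma> j s permutes {1..d j}) \<and>
    filterlim d at_top sequentially \<and>
    (\<forall>s\<in>carrier G. \<forall>t\<in>carrier G.
      (\<lambda>j. hamming_dist (d j) (\<sigma> j s \<circ> \<sigma> j t) (\<sigma> j (s \<otimes>\<^bsub>G\<^esub> t))) \<longlonglongrightarrow> 0) \<and>
    (\<forall>s\<in>carrier G. \<forall>t\<in>carrier G. s \<noteq> t \<longrightarrow>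
      (\<lambda>j. hamming_dist (d j) (\<sigma> j s) (\<sigma> j t)) \<longlonglongrightarrow> 1)"

definition sofic_group :: "('g, 'm) monoid_scheme \<Rightarrow> bool"
  where "sofic_group G \<longleftrightarrow>
    group G \<and> countable (carrier G) \<and> (\<exists>d \<sigma>. sofic_approximation G d \<sigma>)"


section \<open>Sofic topological entropy\<close>

definition rho2 :: "nat \<Rightarrow> (nat \<Rightarrow> 'x :: metric_space) \<Rightarrow> (nat \<Rightarrow> 'x) \<Rightarrow> real"
  where "rho2 d \<phi> \<psi> = sqrt ((\<Sum>a\<in>{1..d}. (dist (\<phi> a) (\<psi> a))\<^sup>2) / real d)"

text \<open>Only meaningful for \<open>d > 0\<close>.\<close>

definition rho_inf :: "nat \<Rightarrow> (nat \<Rightarrow> 'x :: metric_space) \<Rightarrow> (nat \<Rightarrow> 'x) \<Rightarrow> real"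
  where "rho_inf d \<phi> \<psi> = Max ((\<lambda>a. dist (\<phi> a) (\<psi> a)) ` {1..d})"

text \<open>
  Maps \<open>[d] \<rightarrow> X\<close> are taken to be extensional, so that distinct elements of \<open>sofic_maps\<close> are distinct
  maps on \<open>[d]\<close>; this matters for counting them.
\<close>

definition sofic_maps ::
    "'x :: metric_space set \<Rightarrow> ('g \<Rightarrow> 'x \<Rightarrow> 'x) \<Rightarrow> 'g set \<Rightarrow> real \<Rightarrow> nat \<Rightarrow> ('g \<Rightarrow> nat \<Rightarrow> nat) \<Rightarrow>
      (nat \<Rightarrow> 'x) set"
  where "sofic_maps X \<alpha> F \<delta> d \<sigma> =
    {\<phi> \<in> {1..d} \<rightarrow>\<^sub>E X. \<forall>s\<in>F. rho2 d (\<phi> \<circ> \<sigma> s) (\<lambda>a. \<alpha> s (\<phi> a)) < \<delta>}"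

text \<open>
  The supremum over finite separated subsets is the maximal cardinality of a separated subset
  (\<open>\<infinity>\<close> if there are arbitrarily large ones, which does not happen below, by compactness).
\<close>

definition separation_number :: "real \<Rightarrow> ('p \<Rightarrow> 'p \<Rightarrow> real) \<Rightarrow> 'p set \<Rightarrow> enat"
  where "separation_number \<epsilon> r A =
    (SUP S \<in> {S. finite S \<and> S \<subseteq> A \<and> pairwise (\<lambda>p q. r p q \<ge> \<epsilon>) S}. enat (card S))"

definition log_enat :: "enat \<Rightarrow> ereal"
  where "log_enat N =
    (case N of enat n \<Rightarrow> if n = 0 then - \<infinity> else ereal (ln (real n)) | \<infinity> \<Rightarrow> \<infinity>)"

definition sofic_entropy ::
    "('g, 'm) monoid_scheme \<Rightarrow> 'x :: metric_space set \<Rightarrow> ('g \<Rightarrow> 'x \<Rightarrow> 'x) \<Rightarrow>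
      (nat \<Rightarrow> nat) \<Rightarrow> (nat \<Rightarrow> 'g \<Rightarrow> nat \<Rightarrow> nat) \<Rightarrow> ereal"
  where "sofic_entropy G X \<alpha> d \<sigma> =
    (SUP \<epsilon> \<in> {0<..}. INF F \<in> {F. finite F \<and> F \<noteq> {} \<and> F \<subseteq> carrier G}. INF \<delta> \<in> {0<..}.
      limsup (\<lambda>j. ereal (1 / real (d j)) *
        log_enat (separation_number \<epsilon> (rho_inf (d j)) (sofic_maps X \<alpha> F \<delta> (d j) (\<sigma> j)))))"

end

theory Submission
  imports Defs
begin

text \<open>
  Let \<open>f\<close> be an injective endomorphism of \<open>X\<close> that misses a point \<open>x0\<close>. Expansiveness provides a
  finite \<open>K\<close> such that no point of \<open>f X\<close> follows \<open>x0\<close> along \<open>K\<close> within the expansiveness constant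
  \<open>c\<close>. An approximately equivariant map \<open>\<phi> : [d] \<rightarrow> X\<close> gives another one, \<open>f \<circ> \<phi>\<close>, and the
  \<open>K\<close>-pattern of \<open>x0\<close> is visible at none of its accurate vertices. So there is room to plant it: for
  every subset \<open>W\<close> of a sufficiently scattered set \<open>V \<subseteq> [d]\<close> of vertices one can modify \<open>f \<circ> \<phi>\<close> near
  \<open>W\<close> only, so that the pattern of \<open>x0\<close> appears exactly at the vertices of \<open>W\<close> among those of \<open>V\<close>.
  The new map is again approximately equivariant (\<open>transplant_sofic_map\<close>). It determines \<open>W\<close>, and,
  since \<open>f\<close> is an embedding, it determines \<open>\<phi>\<close> except at a bounded number of vertices for each
  element of \<open>W\<close>. If \<open>M\<close> sets of small diameter cover \<open>X\<close>, at most \<open>L ^ |W|\<close> maps \<open>\<phi>\<close>, for a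
  constant power \<open>L\<close> of \<open>M\<close>, are thus confused for the same \<open>W\<close>, and, up to a small loss at
  inaccurate vertices, one family of separated maps yields another one larger by the factor
  \<open>(\<Sum>W\<subseteq>V. (1 / L) ^ |W|) = (1 + 1 / L) ^ |V|\<close> (\<open>separated_transplants\<close>).

  The size of \<open>V\<close> has to be at least a fixed proportion of \<open>d\<close>, whatever precision \<open>(F, \<delta>)\<close> is
  required of the new maps. This is what the strong topological Markov property is for. Gluing by
  the weak specification property leaves an error, and making it small enough for \<open>(F, \<delta>)\<close> would
  take patches that grow with \<open>(F, \<delta>)\<close>. With the Markov property the patches \<open>A\<close> are chosen once and
  for all, and the error is bounded by a fixed fraction \<open>e\<close> of \<open>c\<close> at \<^emph>\<open>all\<close> elements of the group
  (\<open>pattern_surgery_exists\<close>). Expansiveness turns such a bound along a large finite window into an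
  arbitrarily small error.

  Hence there is \<open>\<kappa> > 0\<close> such that for all \<open>(F, \<delta>)\<close> there is \<open>(F', \<delta>')\<close> for which the exponential
  growth rate at scale \<open>c / 4\<close> of the number of maps of precision \<open>(F', \<delta>')\<close> is smaller by \<open>\<kappa>\<close> than
  that for \<open>(F, \<delta>)\<close> (\<open>sofic_maps_count_increases\<close>). But these rates lie in \<open>[0, ln M]\<close>: above \<open>0\<close>
  because the entropy is nonnegative, and below \<open>ln M\<close> by compactness. Choosing \<open>(F, \<delta>)\<close> with a rate
  within \<open>\<kappa>\<close> of the infimum of all rates is contradictory.
\<close>


section \<open>Finite windows of expansive actions\<close>

context dynamical_system
begin

sublocale group G
  using group_hom by (rule group_hom.axioms(1))

lemma act_closed: "g \<in> carrier G \<Longrightarrow> x \<in> X \<Longrightarrow> \<alpha> g x \<in> X"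
  using element_image by blast

lemma act_one: "x \<in> X \<Longrightarrow> \<alpha> \<one> x = x"
  using id_eq_one by (metis restrict_apply')

lemma act_translate_back:
  assumes "k \<in> carrier G" "r \<in> carrier G" "x \<in> X"
  shows "\<alpha> (k \<otimes> r) (\<alpha> (inv r) x) = \<alpha> k x"
  using assms composition_rule[of x "k \<otimes> r" "inv r"] by (simp add: m_assoc)

text \<open>
  Pairs of points at distance at least \<open>\<eta>\<close> form a compact set, covered by the open conditions that
  one group element moves the two points more than \<open>c\<close> apart.
\<close>

lemma expansive_finite_window:
  assumes sep: "\<forall>x\<in>X. \<forall>y\<in>X. x \<noteq> y \<longrightarrow> (\<exists>g\<in>carrier G. dist (\<alpha> g x) (\<alpha> g y) > c)"
    and "\<eta> > 0"
  obtains E where "finite E" "E \<subseteq> carrier G"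
    "\<And>x y. x \<in> X \<Longrightarrow> y \<in> X \<Longrightarrow> (\<And>s. s \<in> E \<Longrightarrow> dist (\<alpha> s x) (\<alpha> s y) \<le> c) \<Longrightarrow> dist x y < \<eta>"
proof -
  define far where "far = {p \<in> X \<times> X. \<eta> \<le> dist (fst p) (snd p)}"
  define U where "U g = {p \<in> X \<times> X. c < dist (\<alpha> g (fst p)) (\<alpha> g (snd p))}" for g
  have "closed {p :: 'x \<times> 'x. \<eta> \<le> dist (fst p) (snd p)}"
    by (intro closed_Collect_le continuous_intros)
  moreover have "far = (X \<times> X) \<inter> {p. \<eta> \<le> dist (fst p) (snd p)}"
    by (auto simp: far_def)
  ultimately have comp: "compact far"
    using compact_Int_closed[OF compact_Times[OF compact_space compact_space]] by simp
  have "\<exists>O'. open O' \<and> U g = (X \<times> X) \<inter> O'" if "g \<in> carrier G" for g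
  proof -
    have cont: "continuous_on (X \<times> X) (\<lambda>p. dist (\<alpha> g (fst p)) (\<alpha> g (snd p)))"
      by (intro continuous_intros continuous_on_compose2[OF continuous_action[OF that]]) auto
    have "openin (top_of_set (X \<times> X)) ((X \<times> X) \<inter> (\<lambda>p. dist (\<alpha> g (fst p)) (\<alpha> g (snd p))) -` {c<..})"
      using cont by (intro continuous_openin_preimage_gen) auto
    moreover have "(X \<times> X) \<inter> (\<lambda>p. dist (\<alpha> g (fst p)) (\<alpha> g (snd p))) -` {c<..} = U g"
      by (auto simp: U_def)
    ultimately show ?thesis by (auto simp: openin_open)
  qed
  then obtain O' where O': "\<And>g. g \<in> carrier G \<Longrightarrow> open (O' g)"
      "\<And>g. g \<in> carrier G \<Longrightarrow> U g = (X \<times> X) \<inter> O' g"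
    by metis
  have "far \<subseteq> (\<Union>g\<in>carrier G. O' g)"
  proof
    fix p assume p: "p \<in> far"
    then have "fst p \<noteq> snd p" "fst p \<in> X" "snd p \<in> X" using \<open>\<eta> > 0\<close> by (auto simp: far_def)
    then obtain g where "g \<in> carrier G" "dist (\<alpha> g (fst p)) (\<alpha> g (snd p)) > c" using sep by blast
    then have "p \<in> U g" using p by (auto simp: U_def far_def)
    then show "p \<in> (\<Union>g\<in>carrier G. O' g)" using O' \<open>g \<in> carrier G\<close> by auto
  qed
  then obtain E where E: "E \<subseteq> carrier G" "finite E" "far \<subseteq> (\<Union>g\<in>E. O' g)"
    using compactE_image[OF comp] O'(1) by metis
  show thesis
  proof
    fix x y assume xy: "x \<in> X" "y \<in> X" and close: "\<And>s. s \<in> E \<Longrightarrow> dist (\<alpha> s x) (\<alpha> s y) \<le> c"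
    show "dist x y < \<eta>"
    proof (rule ccontr)
      assume "\<not> dist x y < \<eta>"
      then have "(x, y) \<in> far" using xy by (auto simp: far_def)
      then obtain g where g: "g \<in> E" "(x, y) \<in> O' g" using E by blast
      then have "(x, y) \<in> U g" using O' E xy by blast
      then show False using close[OF g(1)] by (simp add: U_def)
    qed
  qed (use E in auto)
qed

lemma uniform_continuity_finite:
  assumes "finite S" "S \<subseteq> carrier G" "continuous_on X f" "f \<in> X \<rightarrow> X" "\<eta> > 0"
  obtains \<tau> where "\<tau> > 0"
    "\<And>s x y. s \<in> S \<Longrightarrow> x \<in> X \<Longrightarrow> y \<in> X \<Longrightarrow> dist x y < \<tau> \<Longrightarrow> dist (\<alpha> s (f x)) (\<alpha> s (f y)) < \<eta>"
proof -
  have "\<exists>\<tau>>0. \<forall>x\<in>X. \<forall>y\<in>X. dist x y < \<tau> \<longrightarrow> dist (\<alpha> s (f x)) (\<alpha> s (f y)) < \<eta>" if "s \<in> S" for s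
  proof -
    have "continuous_on X (\<lambda>x. \<alpha> s (f x))"
      using assms that by (intro continuous_on_compose2[OF continuous_action]) auto
    then have "uniformly_continuous_on X (\<lambda>x. \<alpha> s (f x))"
      using compact_space compact_uniformly_continuous by blast
    then show ?thesis using \<open>\<eta> > 0\<close> unfolding uniformly_continuous_on_def by (metis dist_commute)
  qed
  then obtain \<tau> where \<tau>: "\<And>s. s \<in> S \<Longrightarrow> \<tau> s > 0"
    "\<And>s x y. s \<in> S \<Longrightarrow> x \<in> X \<Longrightarrow> y \<in> X \<Longrightarrow> dist x y < \<tau> s \<Longrightarrow> dist (\<alpha> s (f x)) (\<alpha> s (f y)) < \<eta>"
    by metis
  show thesis
  proof
    show "Min (insert 1 (\<tau> ` S)) > 0" using \<tau>(1) \<open>finite S\<close> by auto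
    fix s x y assume *: "s \<in> S" "x \<in> X" "y \<in> X" "dist x y < Min (insert 1 (\<tau> ` S))"
    then have "dist x y < \<tau> s" using \<open>finite S\<close> by simp
    then show "dist (\<alpha> s (f x)) (\<alpha> s (f y)) < \<eta>" using \<tau> * by blast
  qed
qed

text \<open>
  The inverse of the embedding \<open>f\<close> is uniformly continuous on the compact set \<open>f X\<close>, so a window for
  \<open>f X\<close> controls distances in \<open>X\<close>.
\<close>

lemma embedding_finite_window:
  assumes sep: "\<forall>x\<in>X. \<forall>y\<in>X. x \<noteq> y \<longrightarrow> (\<exists>g\<in>carrier G. dist (\<alpha> g x) (\<alpha> g y) > c)"
    and f: "f \<in> X \<rightarrow> X" "continuous_on X f" "inj_on f X"
    and "\<epsilon> > 0"
  obtains E where "finite E" "E \<subseteq> carrier G"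
    "\<And>x y. x \<in> X \<Longrightarrow> y \<in> X \<Longrightarrow> (\<And>s. s \<in> E \<Longrightarrow> dist (\<alpha> s (f x)) (\<alpha> s (f y)) \<le> c) \<Longrightarrow> dist x y < \<epsilon>"
proof -
  have "continuous_on (f ` X) (the_inv_into X f)"
    using continuous_on_inv[OF f(2) compact_space, of "the_inv_into X f"] f(3)
    by (simp add: the_inv_into_f_f)
  then have "uniformly_continuous_on (f ` X) (the_inv_into X f)"
    using compact_continuous_image[OF f(2) compact_space] compact_uniformly_continuous by blast
  then obtain \<eta> where \<eta>: "\<eta> > 0" "\<And>u v. u \<in> f ` X \<Longrightarrow> v \<in> f ` X \<Longrightarrow> dist u v < \<eta> \<Longrightarrow>
      dist (the_inv_into X f u) (the_inv_into X f v) < \<epsilon>"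
    using \<open>\<epsilon> > 0\<close> unfolding uniformly_continuous_on_def by (metis dist_commute)
  obtain E where E: "finite E" "E \<subseteq> carrier G"
    "\<And>x y. x \<in> X \<Longrightarrow> y \<in> X \<Longrightarrow> (\<And>s. s \<in> E \<Longrightarrow> dist (\<alpha> s x) (\<alpha> s y) \<le> c) \<Longrightarrow> dist x y < \<eta>"
    using expansive_finite_window[OF sep \<eta>(1)] by blast
  show thesis
  proof
    fix x y assume xy: "x \<in> X" "y \<in> X"
      and close: "\<And>s. s \<in> E \<Longrightarrow> dist (\<alpha> s (f x)) (\<alpha> s (f y)) \<le> c"
    have "dist (f x) (f y) < \<eta>" using E(3) xy f(1) close by blast
    then show "dist x y < \<epsilon>" using \<eta>(2)[of "f x" "f y"] xy f(3) by (simp add: the_inv_into_f_f)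
  qed (use E in auto)
qed

text \<open>
  The index type is free here because group elements serve as indices below.
\<close>

lemma weak_specification_family:
  fixes \<epsilon> :: real
  assumes "weak_specification G X \<alpha>" "\<epsilon> > 0"
  obtains F where "finite F" "F \<subseteq> carrier G" "\<one> \<in> F" "\<And>s. s \<in> F \<Longrightarrow> inv s \<in> F"
    "\<forall>(T :: 'i set) \<Omega> x. finite T \<longrightarrow> (\<forall>i\<in>T. finite (\<Omega> i) \<and> \<Omega> i \<subseteq> carrier G) \<longrightarrow>
      (\<forall>i\<in>T. \<forall>j\<in>T. i \<noteq> j \<longrightarrow> (F <#> \<Omega> i) \<inter> \<Omega> j = {}) \<longrightarrow> (\<forall>i\<in>T. x i \<in> X) \<longrightarrow>
      (\<exists>z\<in>X. \<forall>i\<in>T. \<forall>s\<in>\<Omega> i. dist (\<alpha> s z) (\<alpha> s (x i)) \<le> \<epsilon>)"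
proof -
  have "\<exists>F. finite F \<and> F \<subseteq> carrier G \<and> set_inv F = F \<and> \<one> \<in> F \<and>
      (\<forall>(I :: nat set) \<Omega> x. finite I \<longrightarrow> (\<forall>i\<in>I. finite (\<Omega> i) \<and> \<Omega> i \<subseteq> carrier G) \<longrightarrow>
        (\<forall>i\<in>I. \<forall>j\<in>I. i \<noteq> j \<longrightarrow> (F <#> \<Omega> i) \<inter> \<Omega> j = {}) \<longrightarrow> (\<forall>i\<in>I. x i \<in> X) \<longrightarrow>
        (\<exists>z\<in>X. \<forall>i\<in>I. \<forall>s\<in>\<Omega> i. dist (\<alpha> s z) (\<alpha> s (x i)) \<le> \<epsilon>))"
    using spec[OF assms(1)[unfolded weak_specification_def], of \<epsilon>] assms(2) by (rule mp)
  then obtain F where F: "finite F" "F \<subseteq> carrier G" "set_inv F = F" "\<one> \<in> F"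
    and spec: "\<forall>(I :: nat set) \<Omega> x. finite I \<longrightarrow> (\<forall>i\<in>I. finite (\<Omega> i) \<and> \<Omega> i \<subseteq> carrier G) \<longrightarrow>
        (\<forall>i\<in>I. \<forall>j\<in>I. i \<noteq> j \<longrightarrow> (F <#> \<Omega> i) \<inter> \<Omega> j = {}) \<longrightarrow> (\<forall>i\<in>I. x i \<in> X) \<longrightarrow>
        (\<exists>z\<in>X. \<forall>i\<in>I. \<forall>s\<in>\<Omega> i. dist (\<alpha> s z) (\<alpha> s (x i)) \<le> \<epsilon>)"
    by (elim exE conjE) (rule that)
  show thesis
  proof
    show "inv s \<in> F" if "s \<in> F" for s
    proof -
      have "inv s \<in> set_inv F" using that unfolding SET_INV_def by blast
      then show ?thesis using F(3) by simp
    qed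
    show "\<forall>(T :: 'i set) \<Omega> x. finite T \<longrightarrow> (\<forall>i\<in>T. finite (\<Omega> i) \<and> \<Omega> i \<subseteq> carrier G) \<longrightarrow>
      (\<forall>i\<in>T. \<forall>j\<in>T. i \<noteq> j \<longrightarrow> (F <#> \<Omega> i) \<inter> \<Omega> j = {}) \<longrightarrow> (\<forall>i\<in>T. x i \<in> X) \<longrightarrow>
      (\<exists>z\<in>X. \<forall>i\<in>T. \<forall>s\<in>\<Omega> i. dist (\<alpha> s z) (\<alpha> s (x i)) \<le> \<epsilon>)"
    proof (intro allI impI)
      fix T :: "'i set" and \<Omega> x
      assume T: "finite T" "\<forall>i\<in>T. finite (\<Omega> i) \<and> \<Omega> i \<subseteq> carrier G"
        "\<forall>i\<in>T. \<forall>j\<in>T. i \<noteq> j \<longrightarrow> (F <#> \<Omega> i) \<inter> \<Omega> j = {}"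
        "\<forall>i\<in>T. x i \<in> X"
      obtain h where h: "bij_betw h {0..<card T} T" using ex_bij_betw_nat_finite[OF T(1)] by blast
      have "\<exists>z\<in>X. \<forall>n\<in>{0..<card T}. \<forall>s\<in>\<Omega> (h n). dist (\<alpha> s z) (\<alpha> s (x (h n))) \<le> \<epsilon>"
      proof (rule spec[rule_format])
        show "finite (\<Omega> (h i)) \<and> \<Omega> (h i) \<subseteq> carrier G" if "i \<in> {0..<card T}" for i
          using that T(2) bij_betw_apply[OF h] by blast
        show "x (h i) \<in> X" if "i \<in> {0..<card T}" for i
          using that T(4) bij_betw_apply[OF h] by blast
        show "(F <#> \<Omega> (h i)) \<inter> \<Omega> (h j) = {}"
          if "i \<in> {0..<card T}" "j \<in> {0..<card T}" "i \<noteq> j" for i j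
          using that T(3) bij_betw_apply[OF h] inj_onD[OF bij_betw_imp_inj_on[OF h]] by blast
      qed simp
      moreover have "\<exists>n\<in>{0..<card T}. i = h n" if "i \<in> T" for i
        using that bij_betw_imp_surj_on[OF h] by blast
      ultimately show "\<exists>z\<in>X. \<forall>i\<in>T. \<forall>s\<in>\<Omega> i. dist (\<alpha> s z) (\<alpha> s (x i)) \<le> \<epsilon>"
        by metis
    qed
  qed (use F in auto)
qed

end


section \<open>Planting a pattern in a single point\<close>

lemma (in group) set_multI: "h \<in> H \<Longrightarrow> k \<in> K \<Longrightarrow> h \<otimes> k \<in> H <#> K"
  unfolding set_mult_def by blast

lemma (in group) finite_set_mult: "finite H \<Longrightarrow> finite K \<Longrightarrow> finite (H <#> K)"
  unfolding set_mult_def by simp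

text \<open>
  A patch \<open>A\<close>, and a map \<open>P\<close> that turns a point \<open>y\<close> into one which shows the \<open>K\<close>-pattern of \<open>x0\<close>. By
  \<open>graft\<close>, all translates \<open>A r\<close> with \<open>r \<in> T\<close> of the orbit of a point \<open>y\<close> can be replaced
  simultaneously, for every finite \<open>Q\<close>-separated \<open>T\<close>. The points \<open>u r\<close> are approximations to \<open>r y\<close>
  along \<open>C\<close> rather than \<open>r y\<close> itself: on a sofic model several vertices see the same patch, and they
  have to agree on the planted copy although their values are only approximately translates of each
  other.
\<close>

locale pattern_surgery = dynamical_system +
  fixes x0 K A C Q \<theta> e P
  assumes finite_A: "finite A" and A_carrier: "A \<subseteq> carrier G"
    and finite_C: "finite C" and C_carrier: "C \<subseteq> carrier G"
    and finite_Q: "finite Q" and Q_carrier: "Q \<subseteq> carrier G"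
    and K_subset: "K \<subseteq> A"
    and theta_pos: "\<theta> > 0" and e_pos: "e > 0"
    and quotients_in_Q: "\<And>k k'. k \<in> A \<Longrightarrow> k' \<in> A \<Longrightarrow> inv k \<otimes> k' \<in> Q"
    and plant_pattern: "\<And>y k. y \<in> X \<Longrightarrow> k \<in> K \<Longrightarrow> dist (\<alpha> k (P y)) (\<alpha> k x0) \<le> e"
    and graft: "\<And>T y u. finite T \<Longrightarrow> T \<subseteq> carrier G \<Longrightarrow>
      (\<And>r r'. r \<in> T \<Longrightarrow> r' \<in> T \<Longrightarrow> r \<noteq> r' \<Longrightarrow> r' \<otimes> inv r \<notin> Q) \<Longrightarrow> y \<in> X \<Longrightarrow>
      (\<And>r. r \<in> T \<Longrightarrow> u r \<in> X) \<Longrightarrow>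
      (\<And>r k. r \<in> T \<Longrightarrow> k \<in> C \<Longrightarrow> dist (\<alpha> k (\<alpha> r y)) (\<alpha> k (u r)) \<le> \<theta>) \<Longrightarrow>
      \<exists>z\<in>X. (\<forall>s \<in> carrier G - (A <#> T). dist (\<alpha> s z) (\<alpha> s y) \<le> e) \<and>
            (\<forall>r\<in>T. \<forall>k\<in>A. dist (\<alpha> (k \<otimes> r) z) (\<alpha> k (P (u r))) \<le> e)"

context dynamical_system
begin

text \<open>
  The patch is \<open>A = S K\<close>, where \<open>S\<close> is the separation required by specification, and \<open>C = F A\<close> where
  \<open>F\<close> comes from the Markov property. Specification gives \<open>P y\<close>, close to \<open>x0\<close> along \<open>K\<close> and to \<open>y\<close>
  along the collar \<open>C - A\<close>. A second use of it, for the sets \<open>C r\<close>, gives a point \<open>x\<close> that shows all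
  the patches with their collars; it is uncontrolled elsewhere. On the collars \<open>x\<close> agrees with \<open>y\<close>,
  so the Markov property glues \<open>x\<close> inside \<open>A T\<close> to \<open>y\<close> outside.
\<close>

lemma pattern_surgery_exists:
  fixes e :: real
  assumes ws: "weak_specification G X \<alpha>" and markov: "strong_topological_Markov G X \<alpha>"
    and "x0 \<in> X" "finite K" "K \<subseteq> carrier G" "e > 0"
  obtains A C Q \<theta> P where "pattern_surgery G X \<alpha> x0 K A C Q \<theta> e P"
proof -
  have "\<exists>\<delta>>0. \<exists>F. finite F \<and> F \<subseteq> carrier G \<and> \<one> \<in> F \<and>
      (\<forall>A x y. finite A \<longrightarrow> A \<subseteq> carrier G \<longrightarrow> x \<in> X \<longrightarrow> y \<in> X \<longrightarrow>
        (\<forall>s \<in> (F <#> A) - A. dist (\<alpha> s x) (\<alpha> s y) \<le> \<delta>) \<longrightarrow>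
        (\<exists>z\<in>X. (\<forall>s \<in> F <#> A. dist (\<alpha> s z) (\<alpha> s x) \<le> e / 2) \<and>
               (\<forall>s \<in> carrier G - A. dist (\<alpha> s z) (\<alpha> s y) \<le> e / 2)))"
    using spec[OF markov[unfolded strong_topological_Markov_def], of "e / 2"]
      half_gt_zero[OF \<open>e > 0\<close>] by (rule mp)
  then obtain \<delta> F where \<delta>: "\<delta> > 0" and F: "finite F" "F \<subseteq> carrier G" "\<one> \<in> F"
    and glue: "\<forall>A x y. finite A \<longrightarrow> A \<subseteq> carrier G \<longrightarrow> x \<in> X \<longrightarrow> y \<in> X \<longrightarrow>
        (\<forall>s \<in> (F <#> A) - A. dist (\<alpha> s x) (\<alpha> s y) \<le> \<delta>) \<longrightarrow>
        (\<exists>z\<in>X. (\<forall>s \<in> F <#> A. dist (\<alpha> s z) (\<alpha> s x) \<le> e / 2) \<and>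
               (\<forall>s \<in> carrier G - A. dist (\<alpha> s z) (\<alpha> s y) \<le> e / 2))"
    by (elim exE conjE) (rule that)
  \<comment> \<open>Three errors of size \<open>\<eta>\<close> add up on the collars: two shadowing errors and the inaccuracy of
    \<open>u r\<close>.\<close>
  define \<eta> where "\<eta> = min (\<delta> / 3) (e / 2)"
  have \<eta>: "\<eta> > 0" "3 * \<eta> \<le> \<delta>" "2 * \<eta> \<le> e" using \<delta> \<open>e > 0\<close> by (auto simp: \<eta>_def)
  obtain S where S: "finite S" "S \<subseteq> carrier G" "\<one> \<in> S" "\<And>s. s \<in> S \<Longrightarrow> inv s \<in> S"
    and shadow2: "\<forall>(T :: nat set) \<Omega> x. finite T \<longrightarrow> (\<forall>i\<in>T. finite (\<Omega> i) \<and> \<Omega> i \<subseteq> carrier G) \<longrightarrow>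
      (\<forall>i\<in>T. \<forall>j\<in>T. i \<noteq> j \<longrightarrow> (S <#> \<Omega> i) \<inter> \<Omega> j = {}) \<longrightarrow> (\<forall>i\<in>T. x i \<in> X) \<longrightarrow>
      (\<exists>z\<in>X. \<forall>i\<in>T. \<forall>s\<in>\<Omega> i. dist (\<alpha> s z) (\<alpha> s (x i)) \<le> \<eta>)"
    by (rule weak_specification_family[OF ws \<eta>(1)]) (rule that)
  obtain S' where S': "finite S'" "S' \<subseteq> carrier G" "\<one> \<in> S'"
    and shadow: "\<forall>(T :: 'g set) \<Omega> x. finite T \<longrightarrow> (\<forall>i\<in>T. finite (\<Omega> i) \<and> \<Omega> i \<subseteq> carrier G) \<longrightarrow>
      (\<forall>i\<in>T. \<forall>j\<in>T. i \<noteq> j \<longrightarrow> (S' <#> \<Omega> i) \<inter> \<Omega> j = {}) \<longrightarrow> (\<forall>i\<in>T. x i \<in> X) \<longrightarrow>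
      (\<exists>z\<in>X. \<forall>i\<in>T. \<forall>s\<in>\<Omega> i. dist (\<alpha> s z) (\<alpha> s (x i)) \<le> \<eta>)"
    by (rule weak_specification_family[OF ws \<eta>(1)]) (rule that)
  define A where "A = S <#> K"
  define C where "C = F <#> A"
  define Q where "Q = (\<lambda>(c, f, c'). inv c \<otimes> f \<otimes> c') ` (C \<times> S' \<times> C)"
  have A: "finite A" "A \<subseteq> carrier G"
    using S(1,2) \<open>finite K\<close> \<open>K \<subseteq> carrier G\<close>
    by (simp_all add: A_def finite_set_mult set_mult_closed)
  have C: "finite C" "C \<subseteq> carrier G"
    using F(1,2) A by (simp_all add: C_def finite_set_mult set_mult_closed)
  have Q: "finite Q" "Q \<subseteq> carrier G"
    using C S'(1,2) by (auto simp: Q_def subsetD)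
  have "K \<subseteq> A"
  proof
    fix k assume "k \<in> K"
    then show "k \<in> A" using set_multI[OF S(3), of k K] \<open>K \<subseteq> carrier G\<close> by (auto simp: A_def)
  qed
  have "A \<subseteq> C"
  proof
    fix k assume "k \<in> A"
    then show "k \<in> C" using set_multI[OF F(3), of k A] A(2) by (auto simp: C_def)
  qed
  \<comment> \<open>The collar is far enough from \<open>K\<close> because \<open>S\<close> is symmetric and \<open>A = S K\<close>.\<close>
  have "\<exists>p\<in>X. (\<forall>k\<in>K. dist (\<alpha> k p) (\<alpha> k x0) \<le> \<eta>) \<and> (\<forall>s\<in>C - A. dist (\<alpha> s p) (\<alpha> s y) \<le> \<eta>)"
    if "y \<in> X" for y
  proof -
    define \<Omega> where "\<Omega> i = (if i = (0::nat) then K else C - A)" for i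
    have "(S <#> (C - A)) \<inter> K = {}"
    proof (rule ccontr)
      assume "(S <#> (C - A)) \<inter> K \<noteq> {}"
      then obtain f c where fc: "f \<in> S" "c \<in> C - A" "f \<otimes> c \<in> K" unfolding set_mult_def by blast
      then have "c = inv f \<otimes> (f \<otimes> c)" using S(2) C(2) by (subst inv_solve_left) auto
      then show False using fc set_multI[OF S(4)[OF fc(1)] fc(3)] by (auto simp: A_def)
    qed
    then have disj: "(S <#> \<Omega> i) \<inter> \<Omega> j = {}" if "i \<in> {0, 1}" "j \<in> {0, 1}" "i \<noteq> j" for i j
      using that by (auto simp: \<Omega>_def A_def)
    have "\<exists>z\<in>X. \<forall>i\<in>{0, 1}. \<forall>s\<in>\<Omega> i. dist (\<alpha> s z) (\<alpha> s (if i = 0 then x0 else y)) \<le> \<eta>"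
      by (rule shadow2[rule_format]) (use disj \<open>x0 \<in> X\<close> \<open>y \<in> X\<close> \<open>finite K\<close> \<open>K \<subseteq> carrier G\<close> C in \<open>auto simp: \<Omega>_def\<close>)
    then show ?thesis by (auto simp: \<Omega>_def)
  qed
  then obtain P where P: "\<And>y. y \<in> X \<Longrightarrow> P y \<in> X"
    "\<And>y k. y \<in> X \<Longrightarrow> k \<in> K \<Longrightarrow> dist (\<alpha> k (P y)) (\<alpha> k x0) \<le> \<eta>"
    "\<And>y s. y \<in> X \<Longrightarrow> s \<in> C - A \<Longrightarrow> dist (\<alpha> s (P y)) (\<alpha> s y) \<le> \<eta>"
    by metis
  have "pattern_surgery G X \<alpha> x0 K A C Q \<eta> e P"
  proof unfold_locales
    show "inv k \<otimes> k' \<in> Q" if "k \<in> A" "k' \<in> A" for k k'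
    proof -
      have "inv k \<otimes> \<one> \<otimes> k' \<in> Q" unfolding Q_def using that S'(3) \<open>A \<subseteq> C\<close> by force
      then show ?thesis using that A(2) by auto
    qed
    show "dist (\<alpha> k (P y)) (\<alpha> k x0) \<le> e" if "y \<in> X" "k \<in> K" for y k
      using P(2)[OF that] \<eta> by linarith
  next
    fix T y u
    assume T: "finite T" "T \<subseteq> carrier G"
      "\<And>r r'. r \<in> T \<Longrightarrow> r' \<in> T \<Longrightarrow> r \<noteq> r' \<Longrightarrow> r' \<otimes> inv r \<notin> Q"
      and yu: "y \<in> X" "\<And>r. r \<in> T \<Longrightarrow> u r \<in> X"
      and close: "\<And>r k. r \<in> T \<Longrightarrow> k \<in> C \<Longrightarrow> dist (\<alpha> k (\<alpha> r y)) (\<alpha> k (u r)) \<le> \<eta>"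
    have AT: "finite (A <#> T)" "A <#> T \<subseteq> carrier G"
      using A T(1,2) by (simp_all add: finite_set_mult set_mult_closed)
    \<comment> \<open>If \<open>f c r = c' r'\<close> then \<open>r' r\<close>-inverse is in \<open>Q\<close>; this is where the form of \<open>Q\<close> comes from.\<close>
    have "\<exists>z\<in>X. \<forall>r\<in>T. \<forall>s\<in>C <#> {r}. dist (\<alpha> s z) (\<alpha> s (\<alpha> (inv r) (P (u r)))) \<le> \<eta>"
    proof (rule shadow[rule_format])
      show "(S' <#> (C <#> {r})) \<inter> (C <#> {r'}) = {}" if r: "r \<in> T" "r' \<in> T" "r \<noteq> r'" for r r'
      proof (rule ccontr)
        assume "(S' <#> (C <#> {r})) \<inter> (C <#> {r'}) \<noteq> {}"
        then obtain f c c' where f: "f \<in> S'" "c \<in> C" "c' \<in> C" "c' \<otimes> r' = f \<otimes> (c \<otimes> r)"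
          unfolding set_mult_def by auto
        have cl: "f \<in> carrier G" "c \<in> carrier G" "c' \<in> carrier G" "r \<in> carrier G" "r' \<in> carrier G"
          using f(1-3) r(1,2) S'(2) C(2) T(2) by auto
        have "r' = inv c' \<otimes> (f \<otimes> (c \<otimes> r))" using cl f(4) inv_solve_left[of r' c' "f \<otimes> (c \<otimes> r)"] by simp
        then have "r' = inv c' \<otimes> f \<otimes> c \<otimes> r" using cl by (simp add: m_assoc)
        then have "r' \<otimes> inv r = inv c' \<otimes> f \<otimes> c" using cl by (simp add: m_assoc)
        moreover have "inv c' \<otimes> f \<otimes> c \<in> Q" unfolding Q_def using f by force
        ultimately show False using T(3)[OF r] by simp
      qed
      show "finite (C <#> {r}) \<and> C <#> {r} \<subseteq> carrier G" if "r \<in> T" for r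
        using that C(1) subsetD[OF T(2) that] set_mult_closed[OF C(2), of "{r}"]
        by (simp add: finite_set_mult)
      show "\<alpha> (inv r) (P (u r)) \<in> X" if "r \<in> T" for r
        using that subsetD[OF T(2) that] P(1) yu(2) by (intro act_closed) auto
    qed (rule T)
    then obtain x where x: "x \<in> X"
      "\<And>r s. r \<in> T \<Longrightarrow> s \<in> C <#> {r} \<Longrightarrow> dist (\<alpha> s x) (\<alpha> s (\<alpha> (inv r) (P (u r)))) \<le> \<eta>"
      by blast
    have x': "dist (\<alpha> (k \<otimes> r) x) (\<alpha> k (P (u r))) \<le> \<eta>" if "r \<in> T" "k \<in> C" for r k
    proof -
      have "k \<in> carrier G" "r \<in> carrier G" using that C(2) T(2) by auto
      then show ?thesis
        using x(2)[OF that(1) set_multI[OF that(2) singletonI]]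
          act_translate_back[of k r "P (u r)"] P(1) yu(2)[OF that(1)] by simp
    qed
    have "\<exists>z\<in>X. (\<forall>s \<in> F <#> (A <#> T). dist (\<alpha> s z) (\<alpha> s x) \<le> e / 2) \<and>
               (\<forall>s \<in> carrier G - (A <#> T). dist (\<alpha> s z) (\<alpha> s y) \<le> e / 2)"
    proof (rule glue[rule_format, OF AT x(1) yu(1)])
      fix s assume s: "s \<in> (F <#> (A <#> T)) - (A <#> T)"
      then obtain f a r where f: "f \<in> F" "a \<in> A" "r \<in> T" "s = f \<otimes> (a \<otimes> r)"
        unfolding set_mult_def by auto
      have cl: "f \<in> carrier G" "a \<in> carrier G" "r \<in> carrier G" using f(1-3) F(2) A(2) T(2) by auto
      define k where "k = f \<otimes> a"
      have k: "k \<in> carrier G" "k \<in> C" "s = k \<otimes> r"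
        using cl f by (auto simp: k_def C_def m_assoc intro: set_multI)
      have "k \<in> C - A" using k s f(3) set_multI[of k A r T] by auto
      then have "dist (\<alpha> k (P (u r))) (\<alpha> k (u r)) \<le> \<eta>" using P(3) yu f by blast
      moreover have "\<alpha> s y = \<alpha> k (\<alpha> r y)" using k cl yu composition_rule by simp
      ultimately show "dist (\<alpha> s x) (\<alpha> s y) \<le> \<delta>"
        using x'[OF f(3) k(2)] close[OF f(3) k(2)] k(3) \<eta>
          dist_triangle[of "\<alpha> s x" "\<alpha> s y" "\<alpha> k (P (u r))"]
          dist_triangle[of "\<alpha> k (P (u r))" "\<alpha> k (\<alpha> r y)" "\<alpha> k (u r)"]
        by (simp add: dist_commute)
    qed
    then obtain z where z: "z \<in> X" "\<And>s. s \<in> F <#> (A <#> T) \<Longrightarrow> dist (\<alpha> s z) (\<alpha> s x) \<le> e / 2"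
      "\<And>s. s \<in> carrier G - (A <#> T) \<Longrightarrow> dist (\<alpha> s z) (\<alpha> s y) \<le> e / 2"
      by blast
    show "\<exists>z\<in>X. (\<forall>s \<in> carrier G - (A <#> T). dist (\<alpha> s z) (\<alpha> s y) \<le> e) \<and>
            (\<forall>r\<in>T. \<forall>k\<in>A. dist (\<alpha> (k \<otimes> r) z) (\<alpha> k (P (u r))) \<le> e)"
    proof (intro bexI conjI ballI)
      show "dist (\<alpha> s z) (\<alpha> s y) \<le> e" if "s \<in> carrier G - (A <#> T)" for s
        using z(3)[OF that] \<open>e > 0\<close> by linarith
      fix r k assume r: "r \<in> T" "k \<in> A"
      have "\<one> \<otimes> (k \<otimes> r) \<in> F <#> (A <#> T)" using r F(3) by (intro set_multI)
      then have "k \<otimes> r \<in> F <#> (A <#> T)" using r A(2) T(2) by (simp add: subset_iff)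
      then have "dist (\<alpha> (k \<otimes> r) z) (\<alpha> (k \<otimes> r) x) \<le> e / 2" by (rule z(2))
      then show "dist (\<alpha> (k \<otimes> r) z) (\<alpha> k (P (u r))) \<le> e"
        using x'[of r k] r \<open>A \<subseteq> C\<close> \<eta> dist_triangle[of "\<alpha> (k \<otimes> r) z" "\<alpha> k (P (u r))" "\<alpha> (k \<otimes> r) x"]
        by auto
    qed (rule z)
  qed (use A C Q \<open>K \<subseteq> A\<close> \<eta> \<open>e > 0\<close> in auto)
  then show thesis by (rule that)
qed

end


section \<open>Planting patterns in maps on a sofic model\<close>

context dynamical_system
begin

definition good_vertices ::
    "'g set \<Rightarrow> real \<Rightarrow> nat \<Rightarrow> ('g \<Rightarrow> nat \<Rightarrow> nat) \<Rightarrow> (nat \<Rightarrow> 'x) \<Rightarrow> nat set"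
  where "good_vertices B \<tau> d \<sigma> \<psi> = {a \<in> {1..d}. \<forall>s\<in>B. \<forall>t\<in>B.
    \<sigma> s (\<sigma> t a) = \<sigma> (s \<otimes> t) a \<and> (s \<noteq> t \<longrightarrow> \<sigma> s a \<noteq> \<sigma> t a) \<and>
    dist (\<alpha> s (\<psi> (\<sigma> t a))) (\<alpha> s (\<alpha> t (\<psi> a))) \<le> \<tau>}"

text \<open>
  New maps are built at good vertices from what those vertices see. Comparing the values at \<open>a\<close> and
  \<open>\<sigma> t a\<close> requires both to be good.
\<close>

definition core_vertices ::
    "'g set \<Rightarrow> real \<Rightarrow> nat \<Rightarrow> ('g \<Rightarrow> nat \<Rightarrow> nat) \<Rightarrow> (nat \<Rightarrow> 'x) \<Rightarrow> nat set"
  where "core_vertices B \<tau> d \<sigma> \<psi> = {a \<in> good_vertices B \<tau> d \<sigma> \<psi>.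
    \<forall>t\<in>B. \<sigma> t a \<in> good_vertices B \<tau> d \<sigma> \<psi>}"

end

text \<open>
  The set \<open>R\<close> consists of the group elements along which a vertex looks for centres of patches, and
  \<open>V\<close> is the set of possible centres. The window \<open>B\<close> contains all group elements along which \<open>\<sigma>\<close> and
  the given map have to be accurate.
\<close>

locale sofic_surgery = pattern_surgery +
  fixes B R :: "'a set" and d :: nat and \<sigma> :: "'a \<Rightarrow> nat \<Rightarrow> nat" and V :: "nat set"
  assumes B_carrier: "B \<subseteq> carrier G" and one_B: "\<one> \<in> B"
    and finite_R: "finite R" and R_subset: "R \<subseteq> B"
    and A_subset: "A \<subseteq> B" and C_subset: "C \<subseteq> B" and Q_subset: "Q \<subseteq> B"
    and inv_A_R: "\<And>k. k \<in> A \<Longrightarrow> inv k \<in> R"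
    and perm: "\<And>s. s \<in> carrier G \<Longrightarrow> \<sigma> s permutes {1..d}"
    and scattered: "\<And>v w q. v \<in> V \<Longrightarrow> w \<in> V \<Longrightarrow> q \<in> Q \<Longrightarrow> v \<noteq> w \<Longrightarrow> \<sigma> q v \<noteq> w"
begin

abbreviation good :: "(nat \<Rightarrow> 'c) \<Rightarrow> nat set"
  where "good \<equiv> good_vertices B (min \<theta> e) d \<sigma>"

abbreviation core :: "(nat \<Rightarrow> 'c) \<Rightarrow> nat set"
  where "core \<equiv> core_vertices B (min \<theta> e) d \<sigma>"

text \<open>
  The centres \<open>\<sigma> r a \<in> W\<close> are seen from \<open>a\<close> as the patches \<open>A r\<close> of the orbit of \<open>\<psi> a\<close>.
\<close>

definition sites :: "nat set \<Rightarrow> nat \<Rightarrow> 'a set"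
  where "sites W a = {r \<in> R. \<sigma> r a \<in> W}"

text \<open>
  This is a relation because a point \<open>\<Psi> a\<close> with these properties is far from unique. At vertices
  that are not good only \<open>\<Psi> a \<in> X\<close> is required.
\<close>

definition transplant :: "(nat \<Rightarrow> 'c) \<Rightarrow> nat set \<Rightarrow> (nat \<Rightarrow> 'c) \<Rightarrow> bool"
  where "transplant \<psi> W \<Psi> \<longleftrightarrow> \<Psi> \<in> {1..d} \<rightarrow>\<^sub>E X \<and> (\<forall>a \<in> good \<psi>.
    (\<forall>s \<in> carrier G - (A <#> sites W a). dist (\<alpha> s (\<Psi> a)) (\<alpha> s (\<psi> a)) \<le> e) \<and>
    (\<forall>r \<in> sites W a. \<forall>k\<in>A. dist (\<alpha> (k \<otimes> r) (\<Psi> a)) (\<alpha> k (P (\<psi> (\<sigma> r a)))) \<le> e))"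

lemma vertex_closed: "s \<in> carrier G \<Longrightarrow> a \<in> {1..d} \<Longrightarrow> \<sigma> s a \<in> {1..d}"
  using permutes_in_image[OF perm] by blast

lemma good_range: "a \<in> good \<psi> \<Longrightarrow> a \<in> {1..d}"
  by (simp add: good_vertices_def)

lemma good_comp: "a \<in> good \<psi> \<Longrightarrow> s \<in> B \<Longrightarrow> t \<in> B \<Longrightarrow> \<sigma> s (\<sigma> t a) = \<sigma> (s \<otimes> t) a"
  unfolding good_vertices_def by blast

lemma good_free: "a \<in> good \<psi> \<Longrightarrow> s \<in> B \<Longrightarrow> t \<in> B \<Longrightarrow> s \<noteq> t \<Longrightarrow> \<sigma> s a \<noteq> \<sigma> t a"
  unfolding good_vertices_def by blast

lemma good_equivariant: "a \<in> good \<psi> \<Longrightarrow> s \<in> B \<Longrightarrow> t \<in> B \<Longrightarrow>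
    dist (\<alpha> s (\<psi> (\<sigma> t a))) (\<alpha> s (\<alpha> t (\<psi> a))) \<le> min \<theta> e"
  unfolding good_vertices_def by blast

lemma good_one:
  assumes "a \<in> good \<psi>" shows "\<sigma> \<one> a = a"
proof -
  have "\<sigma> \<one> (\<sigma> \<one> a) = \<sigma> \<one> a" using good_comp[OF assms one_B one_B] by simp
  then show ?thesis using permutes_inj[OF perm[OF one_closed]] by (simp add: inj_eq)
qed

lemma core_good: "a \<in> core \<psi> \<Longrightarrow> a \<in> good \<psi>"
  and core_translate: "a \<in> core \<psi> \<Longrightarrow> t \<in> B \<Longrightarrow> \<sigma> t a \<in> good \<psi>"
  unfolding core_vertices_def by blast+

lemma sites_carrier: "sites W a \<subseteq> carrier G"
  using R_subset B_carrier by (auto simp: sites_def)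

text \<open>
  At a good vertex two sites \<open>r\<close>, \<open>r'\<close> lead to two different centres, the second being the image of
  the first under \<open>\<sigma> (r' r\<inverse>)\<close>. As \<open>V\<close> is scattered, \<open>r' r\<inverse> \<notin> Q\<close>, so the patches seen from the vertex
  can be grafted.
\<close>

lemma transplant_exists:
  assumes \<psi>: "\<psi> \<in> {1..d} \<rightarrow> X" and "W \<subseteq> V"
  shows "\<exists>\<Psi>. transplant \<psi> W \<Psi>"
proof -
  have "\<exists>z\<in>X. (\<forall>s \<in> carrier G - (A <#> sites W a). dist (\<alpha> s z) (\<alpha> s (\<psi> a)) \<le> e) \<and>
      (\<forall>r \<in> sites W a. \<forall>k\<in>A. dist (\<alpha> (k \<otimes> r) z) (\<alpha> k (P (\<psi> (\<sigma> r a)))) \<le> e)"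
    if a: "a \<in> good \<psi>" for a
  proof (rule graft)
    show "finite (sites W a)" using finite_R by (simp add: sites_def)
    show "sites W a \<subseteq> carrier G" by (rule sites_carrier)
    show "\<psi> a \<in> X" using good_range[OF a] \<psi> by blast
    fix r assume r: "r \<in> sites W a"
    then have rB: "r \<in> B" "r \<in> carrier G" using R_subset B_carrier by (auto simp: sites_def)
    show "\<psi> (\<sigma> r a) \<in> X" using vertex_closed[OF rB(2) good_range[OF a]] \<psi> by blast
    show "dist (\<alpha> k (\<alpha> r (\<psi> a))) (\<alpha> k (\<psi> (\<sigma> r a))) \<le> \<theta>" if "k \<in> C" for k
      using good_equivariant[OF a _ rB(1), of k] that C_subset by (auto simp: dist_commute)
    fix r' assume r': "r' \<in> sites W a" "r \<noteq> r'"
    then have r'B: "r' \<in> B" "r' \<in> carrier G" using R_subset B_carrier by (auto simp: sites_def)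
    show "r' \<otimes> inv r \<notin> Q"
    proof
      assume q: "r' \<otimes> inv r \<in> Q"
      have "\<sigma> (r' \<otimes> inv r) (\<sigma> r a) = \<sigma> (r' \<otimes> inv r \<otimes> r) a"
        using good_comp[OF a _ rB(1)] q Q_subset by blast
      also have "r' \<otimes> inv r \<otimes> r = r'" using rB r'B by (simp add: m_assoc)
      finally have "\<sigma> (r' \<otimes> inv r) (\<sigma> r a) = \<sigma> r' a" .
      moreover have "\<sigma> r a \<noteq> \<sigma> r' a" using good_free[OF a rB(1) r'B(1) r'(2)] .
      moreover have "\<sigma> r a \<in> V" "\<sigma> r' a \<in> V" using r r' \<open>W \<subseteq> V\<close> by (auto simp: sites_def)
      ultimately show False using scattered[OF _ _ q] by blast
    qed
  qed
  then obtain z where z: "\<forall>a \<in> good \<psi>. z a \<in> X \<and>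
      (\<forall>s \<in> carrier G - (A <#> sites W a). dist (\<alpha> s (z a)) (\<alpha> s (\<psi> a)) \<le> e) \<and>
      (\<forall>r \<in> sites W a. \<forall>k\<in>A. dist (\<alpha> (k \<otimes> r) (z a)) (\<alpha> k (P (\<psi> (\<sigma> r a)))) \<le> e)"
    by metis
  define \<Psi> where "\<Psi> = (\<lambda>a\<in>{1..d}. if a \<in> good \<psi> then z a else \<psi> a)"
  have "\<Psi> \<in> {1..d} \<rightarrow>\<^sub>E X" using z \<psi> by (auto simp: \<Psi>_def)
  moreover have "\<Psi> a = z a" if "a \<in> good \<psi>" for a
    using good_range[OF that] that by (simp add: \<Psi>_def)
  ultimately have "transplant \<psi> W \<Psi>" using z by (simp add: transplant_def)
  then show ?thesis by blast
qed

lemma transplant_off: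
  assumes "transplant \<psi> W \<Psi>" "a \<in> good \<psi>" "s \<in> carrier G" "s \<notin> A <#> sites W a"
  shows "dist (\<alpha> s (\<Psi> a)) (\<alpha> s (\<psi> a)) \<le> e"
  using assms unfolding transplant_def by blast

lemma transplant_on:
  assumes "transplant \<psi> W \<Psi>" "a \<in> good \<psi>" "r \<in> sites W a" "k \<in> A"
  shows "dist (\<alpha> (k \<otimes> r) (\<Psi> a)) (\<alpha> k (P (\<psi> (\<sigma> r a)))) \<le> e"
  using assms unfolding transplant_def by blast

lemma transplant_closed: "transplant \<psi> W \<Psi> \<Longrightarrow> a \<in> {1..d} \<Longrightarrow> \<Psi> a \<in> X"
  unfolding transplant_def by blast

text \<open>
  The position \<open>u\<close> seen from \<open>\<sigma> t a\<close> and the position \<open>u t\<close> seen from \<open>a\<close> are the same place of the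
  model, and they lie in a patch or not for the same centre: \<open>window\<close> ensures that a centre visible
  from one vertex is also visible from the other. In a patch both values follow the same planted
  copy, outside all patches both follow \<open>\<psi>\<close>. The bound \<open>3 e\<close> does not depend on how large the set of
  admissible \<open>u\<close> is.
\<close>

lemma transplant_almost_equivariant:
  assumes tr: "transplant \<psi> W \<Psi>" and \<psi>: "\<psi> \<in> {1..d} \<rightarrow> X" and a: "a \<in> core \<psi>"
    and t: "t \<in> B" and u: "u \<in> B"
    and window: "\<And>k. k \<in> A \<Longrightarrow> inv k \<otimes> u \<in> R \<and> inv k \<otimes> u \<otimes> t \<in> R"
  shows "dist (\<alpha> u (\<Psi> (\<sigma> t a))) (\<alpha> u (\<alpha> t (\<Psi> a))) \<le> 3 * e"
proof -
  have ga: "a \<in> good \<psi>" and gta: "\<sigma> t a \<in> good \<psi>" using core_good core_translate a t by blast+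
  have cl: "t \<in> carrier G" "u \<in> carrier G" using t u B_carrier by auto
  have \<Psi>a: "\<Psi> a \<in> X" using transplant_closed[OF tr good_range[OF ga]] .
  have sites_eq: "inv k \<otimes> u \<in> sites W (\<sigma> t a) \<longleftrightarrow> inv k \<otimes> u \<otimes> t \<in> sites W a" if "k \<in> A" for k
    using window[OF that] R_subset good_comp[OF ga _ t, of "inv k \<otimes> u"] by (auto simp: sites_def)
  have ut: "\<alpha> u (\<alpha> t (\<Psi> a)) = \<alpha> (u \<otimes> t) (\<Psi> a)" using composition_rule[OF \<Psi>a cl(2,1)] by simp
  show ?thesis
  proof (cases "\<exists>k\<in>A. inv k \<otimes> u \<in> sites W (\<sigma> t a)")
    case True
    then obtain k where k: "k \<in> A" "inv k \<otimes> u \<in> sites W (\<sigma> t a)" by blast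
    then have k': "inv k \<otimes> u \<otimes> t \<in> sites W a" using sites_eq by blast
    have kc: "k \<in> carrier G" using k A_carrier by blast
    have "\<sigma> (inv k \<otimes> u) (\<sigma> t a) = \<sigma> (inv k \<otimes> u \<otimes> t) a"
      using good_comp[OF ga _ t, of "inv k \<otimes> u"] window[OF k(1)] R_subset by blast
    moreover have "k \<otimes> (inv k \<otimes> u) = u" using kc cl by (simp flip: m_assoc)
    moreover have "k \<otimes> (inv k \<otimes> u \<otimes> t) = u \<otimes> t" using kc cl by (simp flip: m_assoc)
    ultimately have "dist (\<alpha> u (\<Psi> (\<sigma> t a))) (\<alpha> (u \<otimes> t) (\<Psi> a)) \<le> e + e"
      using transplant_on[OF tr gta k(2,1)] transplant_on[OF tr ga k' k(1)]
        dist_triangle2 add_mono order_trans by metis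
    then show ?thesis using ut e_pos by simp
  next
    case False
    have no: "inv k \<otimes> u \<notin> sites W (\<sigma> t a)" "inv k \<otimes> u \<otimes> t \<notin> sites W a" if "k \<in> A" for k
      using False that sites_eq by blast+
    have "u \<notin> A <#> sites W (\<sigma> t a)"
    proof
      assume "u \<in> A <#> sites W (\<sigma> t a)"
      then obtain k r where kr: "k \<in> A" "r \<in> sites W (\<sigma> t a)" "u = k \<otimes> r"
        unfolding set_mult_def by blast
      have "k \<in> carrier G" "r \<in> carrier G" using kr A_carrier sites_carrier by blast+
      then have "r = inv k \<otimes> u" using kr(3) by (simp flip: m_assoc)
      then show False using no kr by blast
    qed
    then have 1: "dist (\<alpha> u (\<Psi> (\<sigma> t a))) (\<alpha> u (\<psi> (\<sigma> t a))) \<le> e"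
      by (rule transplant_off[OF tr gta cl(2)])
    have "u \<otimes> t \<notin> A <#> sites W a"
    proof
      assume "u \<otimes> t \<in> A <#> sites W a"
      then obtain k r where kr: "k \<in> A" "r \<in> sites W a" "u \<otimes> t = k \<otimes> r"
        unfolding set_mult_def by blast
      have kc: "k \<in> carrier G" "r \<in> carrier G" using kr A_carrier sites_carrier by blast+
      have "inv k \<otimes> u \<otimes> t = inv k \<otimes> (k \<otimes> r)" using kr(3) kc cl by (simp add: m_assoc)
      also have "\<dots> = r" using kc by (simp flip: m_assoc)
      finally show False using no kr by auto
    qed
    then have 2: "dist (\<alpha> (u \<otimes> t) (\<Psi> a)) (\<alpha> (u \<otimes> t) (\<psi> a)) \<le> e"
      using transplant_off[OF tr ga] cl by blast
    have "\<psi> a \<in> X" using \<psi> good_range[OF ga] by blast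
    then have "\<alpha> (u \<otimes> t) (\<psi> a) = \<alpha> u (\<alpha> t (\<psi> a))" using composition_rule cl by blast
    then have 3: "dist (\<alpha> u (\<psi> (\<sigma> t a))) (\<alpha> (u \<otimes> t) (\<psi> a)) \<le> e"
      using good_equivariant[OF ga u t] by simp
    show ?thesis unfolding ut
      using 1 2 3 dist_triangle[of "\<alpha> u (\<Psi> (\<sigma> t a))" "\<alpha> (u \<otimes> t) (\<Psi> a)" "\<alpha> u (\<psi> (\<sigma> t a))"]
        dist_triangle2[of "\<alpha> u (\<psi> (\<sigma> t a))" "\<alpha> (u \<otimes> t) (\<Psi> a)" "\<alpha> (u \<otimes> t) (\<psi> a)"]
      by linarith
  qed
qed

lemma transplant_away:
  assumes tr: "transplant \<psi> W \<Psi>" and \<psi>: "\<psi> \<in> {1..d} \<rightarrow> X" and a: "a \<in> core \<psi>" and t: "t \<in> B"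
    and away: "\<And>k. k \<in> A \<Longrightarrow> \<sigma> (inv k) (\<sigma> t a) \<notin> W"
  shows "dist (\<Psi> (\<sigma> t a)) (\<alpha> t (\<psi> a)) \<le> 2 * e"
proof -
  have ga: "a \<in> good \<psi>" and gta: "\<sigma> t a \<in> good \<psi>" using core_good core_translate a t by blast+
  have X: "\<psi> (\<sigma> t a) \<in> X" "\<psi> a \<in> X" "\<Psi> (\<sigma> t a) \<in> X"
    using \<psi> good_range[OF ga] good_range[OF gta] transplant_closed[OF tr] by auto
  have tc: "t \<in> carrier G" using t B_carrier by blast
  have "\<one> \<notin> A <#> sites W (\<sigma> t a)"
  proof
    assume "\<one> \<in> A <#> sites W (\<sigma> t a)"
    then obtain k r where kr: "k \<in> A" "r \<in> sites W (\<sigma> t a)" "\<one> = k \<otimes> r"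
      unfolding set_mult_def by blast
    have "k \<in> carrier G" "r \<in> carrier G" using kr A_carrier sites_carrier by blast+
    then have "r = inv k" using kr(3) by (metis inv_equality inv_inv)
    then show False using away[OF kr(1)] kr(2) by (simp add: sites_def)
  qed
  then have "dist (\<Psi> (\<sigma> t a)) (\<psi> (\<sigma> t a)) \<le> e"
    using transplant_off[OF tr gta one_closed] X by (simp add: act_one)
  moreover have "dist (\<psi> (\<sigma> t a)) (\<alpha> t (\<psi> a)) \<le> e"
    using good_equivariant[OF ga one_B t] X act_one act_closed[OF tc X(2)] by simp
  ultimately show ?thesis using dist_triangle[of "\<Psi> (\<sigma> t a)" "\<alpha> t (\<psi> a)" "\<psi> (\<sigma> t a)"] by linarith
qed

lemma transplant_pattern:
  assumes tr: "transplant \<psi> W \<Psi>" and \<psi>: "\<psi> \<in> {1..d} \<rightarrow> X" and w: "w \<in> core \<psi>" "w \<in> W" and k: "k \<in> K"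
  shows "dist (\<Psi> (\<sigma> k w)) (\<alpha> k x0) \<le> 2 * e"
proof -
  have kA: "k \<in> A" "k \<in> B" "k \<in> carrier G" using k K_subset A_subset B_carrier by auto
  have gw: "w \<in> good \<psi>" and gkw: "\<sigma> k w \<in> good \<psi>" using core_good core_translate w kA by blast+
  have ik: "inv k \<in> R" "inv k \<in> B" using inv_A_R[OF kA(1)] R_subset by auto
  have ret: "\<sigma> (inv k) (\<sigma> k w) = w"
    using good_comp[OF gw ik(2) kA(2)] good_one[OF gw] kA by simp
  have "inv k \<in> sites W (\<sigma> k w)" using ik ret w by (simp add: sites_def)
  then have "dist (\<alpha> (k \<otimes> inv k) (\<Psi> (\<sigma> k w))) (\<alpha> k (P (\<psi> w))) \<le> e"
    using transplant_on[OF tr gkw _ kA(1)] ret by metis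
  moreover have "\<alpha> (k \<otimes> inv k) (\<Psi> (\<sigma> k w)) = \<Psi> (\<sigma> k w)"
    using kA act_one[OF transplant_closed[OF tr good_range[OF gkw]]] by simp
  moreover have "\<psi> w \<in> X" using \<psi> good_range[OF gw] by blast
  ultimately show ?thesis
    using plant_pattern[of "\<psi> w" k] k dist_triangle[of "\<Psi> (\<sigma> k w)" "\<alpha> k x0" "\<alpha> k (P (\<psi> w))"]
    by simp
qed

text \<open>
  The patch around another centre \<open>w' \<in> W\<close> cannot reach \<open>\<sigma> k w\<close>, since otherwise \<open>w'\<close> would be the
  image of \<open>w\<close> under an element of \<open>A\<inverse> A \<subseteq> Q\<close>.
\<close>

lemma transplant_no_pattern:
  assumes tr: "transplant \<psi> W \<Psi>" and \<psi>: "\<psi> \<in> {1..d} \<rightarrow> X"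
    and w: "w \<in> core \<psi>" "w \<in> V" "w \<notin> W" and "W \<subseteq> V" and k: "k \<in> K"
  shows "dist (\<Psi> (\<sigma> k w)) (\<alpha> k (\<psi> w)) \<le> 2 * e"
proof (rule transplant_away[OF tr \<psi> w(1)])
  have kA: "k \<in> A" using k K_subset by auto
  then show "k \<in> B" using A_subset by blast
  fix k' assume k': "k' \<in> A"
  have "\<sigma> (inv k') (\<sigma> k w) = \<sigma> (inv k' \<otimes> k) w"
    using good_comp[OF core_good[OF w(1)]] inv_A_R[OF k'] R_subset kA A_subset by blast
  moreover have "inv k' \<otimes> k \<in> Q" using quotients_in_Q[OF k' kA] .
  ultimately show "\<sigma> (inv k') (\<sigma> k w) \<notin> W"
    using scattered[OF w(2)] w(3) \<open>W \<subseteq> V\<close> by (metis subsetD)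
qed

end


section \<open>Counting separated maps\<close>

lemma sum_Pow_power_card:
  fixes x :: real
  assumes "finite V"
  shows "(\<Sum>W\<in>Pow V. x ^ card W) = (1 + x) ^ card V"
proof -
  have "(\<Prod>v\<in>V. x + 1) = (\<Sum>W\<in>Pow V. (\<Prod>v\<in>W. x) * (\<Prod>v\<in>V - W. 1))"
    using prod_add[OF assms] .
  then show ?thesis by (simp add: add.commute)
qed

lemma maximal_independent_subset:
  assumes "finite Y"
  obtains R where "R \<subseteq> Y" "pairwise (\<lambda>p q. far p q) R"
    "\<forall>y\<in>Y. y \<in> R \<or> (\<exists>p\<in>R. \<not> far y p \<or> \<not> far p y)"
proof -
  define \<R> where "\<R> = {R. R \<subseteq> Y \<and> pairwise far R}"
  have "finite \<R>" using assms by (auto simp: \<R>_def intro: finite_subset[of _ "Pow Y"])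
  moreover have "{} \<in> \<R>" by (simp add: \<R>_def)
  ultimately obtain R where R: "R \<in> \<R>" "\<And>S. S \<in> \<R> \<Longrightarrow> R \<subseteq> S \<Longrightarrow> R = S"
    using finite_has_maximal[of \<R>] by blast
  show thesis
  proof
    show "R \<subseteq> Y" "pairwise far R" using R by (auto simp: \<R>_def)
    show "\<forall>y\<in>Y. y \<in> R \<or> (\<exists>p\<in>R. \<not> far y p \<or> \<not> far p y)"
    proof (rule ccontr)
      assume "\<not> (\<forall>y\<in>Y. y \<in> R \<or> (\<exists>p\<in>R. \<not> far y p \<or> \<not> far p y))"
      then obtain y where "y \<in> Y" and *: "\<not> (y \<in> R \<or> (\<exists>p\<in>R. \<not> far y p \<or> \<not> far p y))"
        by blast
      then have "insert y R \<in> \<R>" using R(1) \<open>y \<in> Y\<close> by (auto simp: \<R>_def pairwise_insert)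
      then show False using R(2)[of "insert y R"] * by blast
    qed
  qed
qed

lemma card_preimage_le:
  assumes "inj_on g U" "finite W" "\<And>u. u \<in> U \<Longrightarrow> g u \<in> W"
  shows "card U \<le> card W"
  using card_inj_on_le[OF assms(1) _ assms(2)] assms(3) by blast

text \<open>
  In a maximal scattered set \<open>V\<close>, every vertex \<open>u\<close> is in \<open>V\<close>, or one of at most \<open>2 |Q|\<close> vertices
  related to an element of \<open>V\<close> by some \<open>\<sigma> q\<close> in one of the two directions.
\<close>

lemma scattered_subset:
  fixes \<sigma> :: "'q \<Rightarrow> 'v \<Rightarrow> 'v"
  assumes "finite U" "finite Q" and inj: "\<And>q. q \<in> Q \<Longrightarrow> inj (\<sigma> q)"
  obtains V where "V \<subseteq> U" "\<forall>v\<in>V. \<forall>w\<in>V. \<forall>q\<in>Q. v \<noteq> w \<longrightarrow> \<sigma> q v \<noteq> w"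
    "card U \<le> (2 * card Q + 1) * card V"
proof -
  obtain V where V: "V \<subseteq> U" "pairwise (\<lambda>v w. \<forall>q\<in>Q. \<sigma> q v \<noteq> w) V"
    "\<forall>u\<in>U. u \<in> V \<or> (\<exists>v\<in>V. \<not> (\<forall>q\<in>Q. \<sigma> q u \<noteq> v) \<or> \<not> (\<forall>q\<in>Q. \<sigma> q v \<noteq> u))"
    by (rule maximal_independent_subset[OF assms(1)]) (rule that)
  have fin: "finite V" using V(1) assms(1) finite_subset by blast
  have "U \<subseteq> V \<union> ((\<Union>q\<in>Q. \<sigma> q ` V) \<union> (\<Union>q\<in>Q. {u \<in> U. \<sigma> q u \<in> V}))" (is "_ \<subseteq> _ \<union> (?I \<union> ?P)")
  proof
    fix u assume "u \<in> U"
    then show "u \<in> V \<union> (?I \<union> ?P)" using bspec[OF V(3), of u] by blast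
  qed
  then have "card U \<le> card (V \<union> (?I \<union> ?P))"
    by (intro card_mono) (use fin assms in auto)
  also have "\<dots> \<le> card V + (card ?I + card ?P)"
    using card_Un_le[of V "?I \<union> ?P"] card_Un_le[of ?I ?P] by linarith
  also have "card ?I \<le> (\<Sum>q\<in>Q. card (\<sigma> q ` V))" by (rule card_UN_le[OF assms(2)])
  also have "\<dots> \<le> card Q * card V" using sum_bounded_above[of Q "\<lambda>q. card (\<sigma> q ` V)" "card V", OF card_image_le[OF fin]]
    by simp
  also have "card ?P \<le> (\<Sum>q\<in>Q. card {u \<in> U. \<sigma> q u \<in> V})" by (rule card_UN_le[OF assms(2)])
  also have "\<dots> \<le> card Q * card V"
  proof -
    have "card {u \<in> U. \<sigma> q u \<in> V} \<le> card V" if "q \<in> Q" for q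
      using inj_on_subset[OF inj[OF that] subset_UNIV] by (intro card_preimage_le[OF _ fin]) auto
    then show ?thesis using sum_bounded_above[of Q "\<lambda>q. card {u \<in> U. \<sigma> q u \<in> V}" "card V"] by simp
  qed
  finally have "card U \<le> (2 * card Q + 1) * card V" by (simp add: algebra_simps)
  then show thesis using V(1,2) by (intro that[of V]) (auto simp: pairwise_def)
qed

lemma rho_inf_less_iff:
  assumes "d > 0"
  shows "rho_inf d \<phi> \<psi> < \<epsilon> \<longleftrightarrow> (\<forall>a\<in>{1..d}. dist (\<phi> a) (\<psi> a) < \<epsilon>)"
  unfolding rho_inf_def using assms by (subst Max_less_iff) auto

lemma compact_finite_partition:
  fixes X :: "'x :: metric_space set"
  assumes "compact X" "\<epsilon> > 0"
  obtains M :: nat and cls :: "'x \<Rightarrow> nat" where "M > 0" "\<And>x. x \<in> X \<Longrightarrow> cls x < M"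
    "\<And>x y. x \<in> X \<Longrightarrow> y \<in> X \<Longrightarrow> cls x = cls y \<Longrightarrow> dist x y < \<epsilon>"
proof -
  obtain k where k: "finite k" "X \<subseteq> (\<Union>x\<in>k. ball x (\<epsilon> / 2))"
    using compact_eq_totally_bounded[of X] assms by (meson half_gt_zero)
  obtain h where h: "bij_betw h k {0..<card k}" using ex_bij_betw_finite_nat[OF k(1)] by blast
  have "\<forall>x\<in>X. \<exists>p\<in>k. dist p x < \<epsilon> / 2" using k(2) by (force simp: subset_iff)
  then obtain g where g: "\<And>x. x \<in> X \<Longrightarrow> g x \<in> k" "\<And>x. x \<in> X \<Longrightarrow> dist (g x) x < \<epsilon> / 2" by metis
  show thesis
  proof
    show "card k + 1 > 0" by simp
    show "h (g x) < card k + 1" if "x \<in> X" for x using bij_betw_apply[OF h g(1)[OF that]] by simp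
    fix x y assume xy: "x \<in> X" "y \<in> X" "h (g x) = h (g y)"
    then have "g x = g y" using h g(1) by (auto simp: bij_betw_def inj_on_def)
    then show "dist x y < \<epsilon>"
      using g(2)[OF xy(1)] g(2)[OF xy(2)] dist_triangle_half_r[of "g x" x \<epsilon> y] by metis
  qed
qed

text \<open>
  Separated maps that are close to each other off \<open>P\<close> are told apart by the cells of their values on
  \<open>P\<close>.
\<close>

lemma card_separated_le:
  assumes "d > 0" and S: "S \<subseteq> {1..d} \<rightarrow> X" "pairwise (\<lambda>\<phi> \<psi>. rho_inf d \<phi> \<psi> \<ge> \<epsilon>) S"
    and cls: "\<And>x. x \<in> X \<Longrightarrow> cls x < (M :: nat)"
      "\<And>x y. x \<in> X \<Longrightarrow> y \<in> X \<Longrightarrow> cls x = cls y \<Longrightarrow> dist x y < \<epsilon>"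
    and P: "P \<subseteq> {1..d}"
    and close: "\<And>\<phi> \<psi> a. \<phi> \<in> S \<Longrightarrow> \<psi> \<in> S \<Longrightarrow> a \<in> {1..d} - P \<Longrightarrow> dist (\<phi> a) (\<psi> a) < \<epsilon>"
  shows "finite S \<and> card S \<le> M ^ card P"
proof -
  define code where "code \<phi> = restrict (\<lambda>a. cls (\<phi> a)) P" for \<phi> :: "nat \<Rightarrow> 'a"
  have "inj_on code S"
  proof (rule inj_onI, rule ccontr)
    fix \<phi> \<psi> assume *: "\<phi> \<in> S" "\<psi> \<in> S" "code \<phi> = code \<psi>" "\<phi> \<noteq> \<psi>"
    have "dist (\<phi> a) (\<psi> a) < \<epsilon>" if a: "a \<in> {1..d}" for a
    proof (cases "a \<in> P")
      case True
      then have "cls (\<phi> a) = cls (\<psi> a)" using fun_cong[OF *(3), of a] by (simp add: code_def)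
      then show ?thesis using cls(2) S(1) * a by blast
    qed (use close * a in blast)
    then have "rho_inf d \<phi> \<psi> < \<epsilon>" by (simp add: rho_inf_less_iff[OF \<open>d > 0\<close>])
    then show False using pairwiseD[OF S(2) *(1,2,4)] by linarith
  qed
  moreover have "code ` S \<subseteq> P \<rightarrow>\<^sub>E {..<M}" 
    using cls(1) funcset_mem[OF subsetD[OF S(1)]] subsetD[OF P] by (auto simp: code_def)
  moreover have "finite P" using P finite_subset by blast
  ultimately show ?thesis
    using card_inj_on_le[of code S "P \<rightarrow>\<^sub>E {..<M}"] inj_on_finite[of code S "P \<rightarrow>\<^sub>E {..<M}"]
    by (simp add: finite_PiE card_PiE)
qed

text \<open>
  Objects \<open>\<phi>\<close> are modified by subsets \<open>W\<close>, and close results come from the same \<open>W\<close>. For each \<open>W\<close> a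
  maximal separated set of results represents all \<open>\<phi> \<in> S\<close>, each of its points standing for at most
  \<open>m L ^ |W|\<close> of them: those within \<open>\<epsilon>\<close> of the point, hence within \<open>2 \<epsilon>\<close> of each other. The union
  over all \<open>W\<close> of these sets has the required size.
\<close>

lemma separated_family_card:
  fixes \<Psi> :: "'s \<Rightarrow> 'v set \<Rightarrow> nat \<Rightarrow> 'x :: metric_space" and L m \<epsilon> :: real
  assumes "d > 0" "\<epsilon> > 0" "finite S" "finite V" "L > 0" "m > 0"
    and determine: "\<And>\<phi> \<phi>' W W'. \<phi> \<in> S \<Longrightarrow> \<phi>' \<in> S \<Longrightarrow> W \<subseteq> V \<Longrightarrow> W' \<subseteq> V \<Longrightarrow>
      rho_inf d (\<Psi> \<phi> W) (\<Psi> \<phi>' W') < \<epsilon> \<Longrightarrow> W \<subseteq> W'"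
    and multiplicity: "\<And>W T. W \<subseteq> V \<Longrightarrow> T \<subseteq> S \<Longrightarrow>
      (\<And>\<phi> \<phi>' a. \<phi> \<in> T \<Longrightarrow> \<phi>' \<in> T \<Longrightarrow> a \<in> {1..d} \<Longrightarrow> dist (\<Psi> \<phi> W a) (\<Psi> \<phi>' W a) < 2 * \<epsilon>) \<Longrightarrow>
      real (card T) \<le> m * L ^ card W"
  obtains R where "finite R" "R \<subseteq> {\<Psi> \<phi> W |\<phi> W. \<phi> \<in> S \<and> W \<subseteq> V}"
    "pairwise (\<lambda>p q. rho_inf d p q \<ge> \<epsilon>) R"
    "real (card S) * (1 + 1 / L) ^ card V \<le> m * real (card R)"
proof -
  have sym: "rho_inf d p q = rho_inf d q p" for p q :: "nat \<Rightarrow> 'x"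
    by (simp add: rho_inf_def dist_commute)
  have refl: "rho_inf d p p < \<epsilon>" for p :: "nat \<Rightarrow> 'x"
    using \<open>\<epsilon> > 0\<close> by (simp add: rho_inf_less_iff[OF \<open>d > 0\<close>])
  have "\<exists>R. R \<subseteq> (\<lambda>\<phi>. \<Psi> \<phi> W) ` S \<and> pairwise (\<lambda>p q. rho_inf d p q \<ge> \<epsilon>) R \<and>
      (\<forall>y\<in>(\<lambda>\<phi>. \<Psi> \<phi> W) ` S. \<exists>p\<in>R. rho_inf d y p < \<epsilon>)" for W
  proof -
    have "finite ((\<lambda>\<phi>. \<Psi> \<phi> W) ` S)" using \<open>finite S\<close> by simp
    then obtain R where R: "R \<subseteq> (\<lambda>\<phi>. \<Psi> \<phi> W) ` S" "pairwise (\<lambda>p q. rho_inf d p q \<ge> \<epsilon>) R"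
      "\<forall>y\<in>(\<lambda>\<phi>. \<Psi> \<phi> W) ` S.
        y \<in> R \<or> (\<exists>p\<in>R. \<not> \<epsilon> \<le> rho_inf d y p \<or> \<not> \<epsilon> \<le> rho_inf d p y)"
      by (rule maximal_independent_subset) (rule that)
    have "\<exists>p\<in>R. rho_inf d y p < \<epsilon>" if "y \<in> (\<lambda>\<phi>. \<Psi> \<phi> W) ` S" for y
      using bspec[OF R(3) that] refl sym[of y] by (auto simp: not_le)
    then show ?thesis using R(1,2) by blast
  qed
  then obtain R where R: "\<And>W. R W \<subseteq> (\<lambda>\<phi>. \<Psi> \<phi> W) ` S"
    "\<And>W. pairwise (\<lambda>p q. rho_inf d p q \<ge> \<epsilon>) (R W)"
    "\<And>W y. y \<in> (\<lambda>\<phi>. \<Psi> \<phi> W) ` S \<Longrightarrow> \<exists>p\<in>R W. rho_inf d y p < \<epsilon>"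
    by metis
  have finR: "finite (R W)" for W
    by (rule finite_subset[OF R(1) finite_imageI[OF \<open>finite S\<close>]])
  have count: "real (card S) * (1 / L) ^ card W \<le> m * real (card (R W))" if W: "W \<subseteq> V" for W
  proof -
    define N where "N p = {\<phi>\<in>S. rho_inf d (\<Psi> \<phi> W) p < \<epsilon>}" for p
    have N: "real (card (N p)) \<le> m * L ^ card W" for p
    proof (rule multiplicity[OF W])
      show "N p \<subseteq> S" by (auto simp: N_def)
      fix \<phi> \<phi>' a assume *: "\<phi> \<in> N p" "\<phi>' \<in> N p" "a \<in> {1..d}"
      then have "dist (\<Psi> \<phi> W a) (p a) < \<epsilon>" "dist (\<Psi> \<phi>' W a) (p a) < \<epsilon>"
        by (auto simp: N_def rho_inf_less_iff[OF \<open>d > 0\<close>])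
      then show "dist (\<Psi> \<phi> W a) (\<Psi> \<phi>' W a) < 2 * \<epsilon>"
        using dist_triangle2[of "\<Psi> \<phi> W a" "\<Psi> \<phi>' W a" "p a"] by linarith
    qed
    have "S = (\<Union>p\<in>R W. N p)" using R(3)[of _ W] by (auto simp: N_def)
    then have "card S \<le> (\<Sum>p\<in>R W. card (N p))" using card_UN_le[OF finR] by metis
    then have "real (card S) \<le> (\<Sum>p\<in>R W. real (card (N p)))" by (metis of_nat_le_iff of_nat_sum)
    also have "\<dots> \<le> real (card (R W)) * (m * L ^ card W)"
      using sum_bounded_above[of "R W" "\<lambda>p. real (card (N p))" "m * L ^ card W"] N by simp
    finally show ?thesis using \<open>L > 0\<close> by (simp add: field_simps)
  qed
  define U where "U = (\<Union>W\<in>Pow V. R W)"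
  have eqW: "W = W'" if W: "W \<subseteq> V" "W' \<subseteq> V" "p \<in> R W" "q \<in> R W'" "rho_inf d p q < \<epsilon>" for p q W W'
  proof -
    obtain \<phi> \<phi>' where "\<phi> \<in> S" "\<phi>' \<in> S" "p = \<Psi> \<phi> W" "q = \<Psi> \<phi>' W'"
      using subsetD[OF R(1) W(3)] subsetD[OF R(1) W(4)] by blast
    then show ?thesis
      using determine[of \<phi> \<phi>' W W'] determine[of \<phi>' \<phi> W' W] W sym[of p q] by auto
  qed
  show thesis
  proof
    show "finite U" using \<open>finite V\<close> finR by (simp add: U_def)
    show "U \<subseteq> {\<Psi> \<phi> W |\<phi> W. \<phi> \<in> S \<and> W \<subseteq> V}" using R(1) unfolding U_def by blast
    show "pairwise (\<lambda>p q. rho_inf d p q \<ge> \<epsilon>) U"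
    proof (rule pairwiseI, rule ccontr)
      fix p q assume pq: "p \<in> U" "q \<in> U" "p \<noteq> q" "\<not> \<epsilon> \<le> rho_inf d p q"
      then obtain W W' where W: "W \<subseteq> V" "W' \<subseteq> V" "p \<in> R W" "q \<in> R W'" by (auto simp: U_def)
      then have "W = W'" using eqW pq(4) by simp
      then show False using R(2)[of W] W pq by (auto simp: pairwise_def)
    qed
    have "disjoint_family_on R (Pow V)"
      unfolding disjoint_family_on_def using eqW refl by blast
    then have "card U = (\<Sum>W\<in>Pow V. card (R W))"
      unfolding U_def using \<open>finite V\<close> finR by (intro card_UN_disjoint) (auto simp: disjoint_family_on_def)
    then have "m * real (card U) = (\<Sum>W\<in>Pow V. m * real (card (R W)))"
      by (simp add: sum_distrib_left)
    also have "\<dots> \<ge> (\<Sum>W\<in>Pow V. real (card S) * (1 / L) ^ card W)"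
      using count by (intro sum_mono) auto
    also have "(\<Sum>W\<in>Pow V. real (card S) * (1 / L) ^ card W) = real (card S) * (1 + 1 / L) ^ card V"
      using sum_Pow_power_card[OF \<open>finite V\<close>, of "1 / L"] by (simp flip: sum_distrib_left)
    finally show "real (card S) * (1 + 1 / L) ^ card V \<le> m * real (card U)" .
  qed
qed


section \<open>Separated families of modified maps\<close>

context sofic_surgery
begin

text \<open>
  At the vertices outside \<open>D\<close> the error \<open>3 e \<le> c\<close> along the window \<open>E\<close> becomes an error below
  \<open>\<delta> / 2\<close> by expansiveness; the few vertices in \<open>D\<close> contribute at most \<open>\<delta>\<^sup>2 / 2\<close> to the mean square.
\<close>

lemma transplant_sofic_map:
  assumes tr: "transplant \<psi> W \<Psi>" and \<psi>: "\<psi> \<in> {1..d} \<rightarrow> X" and "d > 0"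
    and D: "D \<subseteq> {1..d}" "{1..d} - D \<subseteq> core \<psi>" "real (card D) * \<Delta>\<^sup>2 \<le> real d * \<delta>\<^sup>2 / 2"
    and diam: "\<And>x y. x \<in> X \<Longrightarrow> y \<in> X \<Longrightarrow> dist x y \<le> \<Delta>"
    and F: "F \<subseteq> B" and E: "E \<subseteq> B"
    and window: "\<And>k u t. k \<in> A \<Longrightarrow> u \<in> E \<Longrightarrow> t \<in> F \<Longrightarrow> inv k \<otimes> u \<in> R \<and> inv k \<otimes> u \<otimes> t \<in> R"
    and sep: "\<And>x y. x \<in> X \<Longrightarrow> y \<in> X \<Longrightarrow> (\<And>u. u \<in> E \<Longrightarrow> dist (\<alpha> u x) (\<alpha> u y) \<le> c) \<Longrightarrow>
      dist x y < \<delta> / 2"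
    and "3 * e \<le> c" "\<delta> > 0"
  shows "\<Psi> \<in> sofic_maps X \<alpha> F \<delta> d \<sigma>"
proof -
  have "rho2 d (\<Psi> \<circ> \<sigma> t) (\<lambda>a. \<alpha> t (\<Psi> a)) < \<delta>" if t: "t \<in> F" for t
  proof -
    have tB: "t \<in> B" "t \<in> carrier G" using t F B_carrier by auto
    have closed: "\<Psi> (\<sigma> t a) \<in> X" "\<alpha> t (\<Psi> a) \<in> X" if "a \<in> {1..d}" for a
      using transplant_closed[OF tr] vertex_closed[OF tB(2) that] act_closed[OF tB(2)] that by auto
    have point: "(dist (\<Psi> (\<sigma> t a)) (\<alpha> t (\<Psi> a)))\<^sup>2 \<le> (\<delta> / 2)\<^sup>2 + (if a \<in> D then \<Delta>\<^sup>2 else 0)"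
      if a: "a \<in> {1..d}" for a
    proof (cases "a \<in> D")
      case True
      have "(dist (\<Psi> (\<sigma> t a)) (\<alpha> t (\<Psi> a)))\<^sup>2 \<le> \<Delta>\<^sup>2"
        using diam[OF closed[OF a]] by (intro power_mono) auto
      then show ?thesis using True by (simp add: add.commute add_increasing2)
    next
      case False
      then have ca: "a \<in> core \<psi>" using D(2) a by blast
      have "dist (\<Psi> (\<sigma> t a)) (\<alpha> t (\<Psi> a)) < \<delta> / 2"
      proof (rule sep[OF closed[OF a]])
        fix u assume u: "u \<in> E"
        have "dist (\<alpha> u (\<Psi> (\<sigma> t a))) (\<alpha> u (\<alpha> t (\<Psi> a))) \<le> 3 * e"
          by (rule transplant_almost_equivariant[OF tr \<psi> ca tB(1)]) (use u E window t in auto)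
        then show "dist (\<alpha> u (\<Psi> (\<sigma> t a))) (\<alpha> u (\<alpha> t (\<Psi> a))) \<le> c" using \<open>3 * e \<le> c\<close> by linarith
      qed
      then have "(dist (\<Psi> (\<sigma> t a)) (\<alpha> t (\<Psi> a)))\<^sup>2 \<le> (\<delta> / 2)\<^sup>2" by (intro power_mono) auto
      then show ?thesis using False by simp
    qed
    have "(\<Sum>a\<in>{1..d}. (dist ((\<Psi> \<circ> \<sigma> t) a) (\<alpha> t (\<Psi> a)))\<^sup>2)
        \<le> (\<Sum>a\<in>{1..d}. (\<delta> / 2)\<^sup>2 + (if a \<in> D then \<Delta>\<^sup>2 else 0))"
      using point by (intro sum_mono) simp
    also have "\<dots> = real d * (\<delta> / 2)\<^sup>2 + real (card D) * \<Delta>\<^sup>2"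
      using D(1) by (simp add: sum.distrib sum.If_cases Int_absorb1)
    also have "\<dots> \<le> real d * (3 / 4 * \<delta>\<^sup>2)" using D(3) by (simp add: power2_eq_square algebra_simps)
    also have "\<dots> < real d * \<delta>\<^sup>2" using \<open>d > 0\<close> \<open>\<delta> > 0\<close> by simp
    finally have "(\<Sum>a\<in>{1..d}. (dist ((\<Psi> \<circ> \<sigma> t) a) (\<alpha> t (\<Psi> a)))\<^sup>2) / real d < \<delta>\<^sup>2"
      using \<open>d > 0\<close> by (simp add: field_simps)
    then show ?thesis unfolding rho2_def using \<open>\<delta> > 0\<close>
      by (intro real_less_lsqrt) (auto intro!: divide_nonneg_nonneg sum_nonneg)
  qed
  then show ?thesis using tr by (auto simp: sofic_maps_def transplant_def)
qed

text \<open>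
  The hypotheses say that \<open>f X\<close> misses the pattern of \<open>x0\<close>, and that \<open>f\<close> can be inverted along \<open>E'\<close>.
  If the pattern were planted at \<open>w\<close> in one of two close maps but not in the other, \<open>f (\<phi>' w)\<close> would
  follow \<open>x0\<close> along \<open>K\<close>. For the same \<open>W\<close>, closeness of the modified maps carries back to \<open>\<phi>\<close> and
  \<open>\<phi>'\<close> at each vertex \<open>a\<close> outside \<open>D\<close> whose \<open>E'\<close>-neighbours are outside the patches, that is,
  outside a set of at most \<open>|D| + |E'| |A| |W|\<close> vertices.
\<close>

lemma separated_transplants:
  assumes "d > 0" and f: "f \<in> X \<rightarrow> X" and scales: "0 < \<epsilon>" "2 * \<epsilon> + 4 * e \<le> c"
    and missing: "\<And>y. y \<in> X \<Longrightarrow> \<exists>k\<in>K. dist (\<alpha> k x0) (\<alpha> k (f y)) > c"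
    and E': "finite E'" "E' \<subseteq> B"
    and decode: "\<And>x y. x \<in> X \<Longrightarrow> y \<in> X \<Longrightarrow>
      (\<And>s. s \<in> E' \<Longrightarrow> dist (\<alpha> s (f x)) (\<alpha> s (f y)) \<le> c) \<Longrightarrow> dist x y < \<epsilon>"
    and cls: "M > 0" "\<And>x. x \<in> X \<Longrightarrow> cls x < (M :: nat)"
      "\<And>x y. x \<in> X \<Longrightarrow> y \<in> X \<Longrightarrow> cls x = cls y \<Longrightarrow> dist x y < \<epsilon>"
    and S: "finite S" "S \<subseteq> {1..d} \<rightarrow> X" "pairwise (\<lambda>\<phi> \<psi>. rho_inf d \<phi> \<psi> \<ge> \<epsilon>) S"
    and D: "D \<subseteq> {1..d}" "\<And>\<phi>. \<phi> \<in> S \<Longrightarrow> {1..d} - D \<subseteq> core (f \<circ> \<phi>)"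
    and V: "V \<subseteq> {1..d} - D"
  obtains T where "finite T" "\<forall>p\<in>T. \<exists>\<phi>\<in>S. \<exists>W\<subseteq>V. transplant (f \<circ> \<phi>) W p"
    "pairwise (\<lambda>p q. rho_inf d p q \<ge> \<epsilon>) T"
    "real (card S) * (1 + 1 / real M ^ (card E' * card A)) ^ card V \<le> real M ^ card D * real (card T)"
proof -
  have f\<phi>: "f \<circ> \<phi> \<in> {1..d} \<rightarrow> X" if "\<phi> \<in> S" for \<phi> using that S(2) f by fastforce
  define \<Psi> where "\<Psi> \<phi> W = (SOME p. transplant (f \<circ> \<phi>) W p)" for \<phi> W
  have tr: "transplant (f \<circ> \<phi>) W (\<Psi> \<phi> W)" if "\<phi> \<in> S" "W \<subseteq> V" for \<phi> W
    unfolding \<Psi>_def using someI_ex[OF transplant_exists[OF f\<phi>[OF that(1)] that(2)]] by simp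
  have finV: "finite V" using V finite_subset by blast
  have "finite D" using D(1) finite_subset by blast
  have determine: "W \<subseteq> W'"
    if *: "\<phi> \<in> S" "\<phi>' \<in> S" "W \<subseteq> V" "W' \<subseteq> V" "rho_inf d (\<Psi> \<phi> W) (\<Psi> \<phi>' W') < \<epsilon>" for \<phi> \<phi>' W W'
  proof
    fix w assume w: "w \<in> W"
    show "w \<in> W'"
    proof (rule ccontr)
      assume w': "w \<notin> W'"
      have wV: "w \<in> V" "w \<in> {1..d}" "w \<in> core (f \<circ> \<phi>)" "w \<in> core (f \<circ> \<phi>')"
        using w *(3) V D(2)[OF *(1)] D(2)[OF *(2)] by auto
      have "\<phi>' w \<in> X" using S(2) *(2) wV(2) by blast
      then obtain k where k: "k \<in> K" "dist (\<alpha> k x0) (\<alpha> k (f (\<phi>' w))) > c" using missing by blast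
      have "dist (\<Psi> \<phi> W (\<sigma> k w)) (\<alpha> k x0) \<le> 2 * e"
        by (rule transplant_pattern[OF tr[OF *(1,3)] f\<phi>[OF *(1)] wV(3) w k(1)])
      moreover have "dist (\<Psi> \<phi>' W' (\<sigma> k w)) (\<alpha> k (f (\<phi>' w))) \<le> 2 * e"
        using transplant_no_pattern[OF tr[OF *(2,4)] f\<phi>[OF *(2)] wV(4,1) w' *(4) k(1)] by simp
      moreover have "k \<in> carrier G" using k(1) K_subset A_carrier by blast
      then have "dist (\<Psi> \<phi> W (\<sigma> k w)) (\<Psi> \<phi>' W' (\<sigma> k w)) < \<epsilon>"
        using *(5) vertex_closed[OF _ wV(2)] by (simp only: rho_inf_less_iff[OF \<open>d > 0\<close>])
      ultimately show False
        using k(2) scales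
          dist_triangle[of "\<alpha> k x0" "\<alpha> k (f (\<phi>' w))" "\<Psi> \<phi> W (\<sigma> k w)"]
          dist_triangle[of "\<Psi> \<phi> W (\<sigma> k w)" "\<alpha> k (f (\<phi>' w))" "\<Psi> \<phi>' W' (\<sigma> k w)"]
        by (simp add: dist_commute)
    qed
  qed
  have multiplicity: "real (card T) \<le> real M ^ card D * (real M ^ (card E' * card A)) ^ card W"
    if W: "W \<subseteq> V" and T: "T \<subseteq> S"
      and close: "\<And>\<phi> \<phi>' a. \<phi> \<in> T \<Longrightarrow> \<phi>' \<in> T \<Longrightarrow> a \<in> {1..d} \<Longrightarrow> dist (\<Psi> \<phi> W a) (\<Psi> \<phi>' W a) < 2 * \<epsilon>"
    for W T
  proof -
    define N where "N = {a \<in> {1..d}. \<exists>s\<in>E'. \<exists>k\<in>A. \<sigma> (inv k) (\<sigma> s a) \<in> W}"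
    have finW: "finite W" using W finV finite_subset by blast
    have N: "card N \<le> card E' * card A * card W"
    proof -
      have "N = (\<Union>(s, k)\<in>E' \<times> A. {a \<in> {1..d}. \<sigma> (inv k) (\<sigma> s a) \<in> W})" by (auto simp: N_def)
      then have "card N \<le> (\<Sum>(s, k)\<in>E' \<times> A. card {a \<in> {1..d}. \<sigma> (inv k) (\<sigma> s a) \<in> W})"
        using card_UN_le[of "E' \<times> A" "\<lambda>(s, k). {a \<in> {1..d}. \<sigma> (inv k) (\<sigma> s a) \<in> W}"] E'(1) finite_A
        by (simp add: case_prod_beta')
      also have "\<dots> \<le> (\<Sum>(s, k)\<in>E' \<times> A. card W)"
      proof (rule sum_mono, clarify)
        fix s k assume sk: "s \<in> E'" "k \<in> A"
        then have c: "s \<in> carrier G" "inv k \<in> carrier G" using E'(2) B_carrier A_carrier by auto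
        have "inj (\<lambda>a. \<sigma> (inv k) (\<sigma> s a))"
          using inj_compose[OF permutes_inj[OF perm[OF c(2)]] permutes_inj[OF perm[OF c(1)]]]
          by (simp add: comp_def)
        then show "card {a \<in> {1..d}. \<sigma> (inv k) (\<sigma> s a) \<in> W} \<le> card W"
          by (intro card_preimage_le[OF inj_on_subset finW]) auto
      qed
      also have "\<dots> = card E' * card A * card W" by (simp add: case_prod_beta' card_cartesian_product)
      finally show ?thesis .
    qed
    have "card T \<le> M ^ card (D \<union> N)"
    proof (rule conjunct2[OF card_separated_le[OF \<open>d > 0\<close> _ _ cls(2,3)]])
      show "T \<subseteq> {1..d} \<rightarrow> X" using T S(2) by blast
      show "pairwise (\<lambda>\<phi> \<psi>. rho_inf d \<phi> \<psi> \<ge> \<epsilon>) T" by (rule pairwise_subset[OF S(3) T])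
      show "D \<union> N \<subseteq> {1..d}" using D(1) by (auto simp: N_def)
      fix \<phi> \<phi>' a assume p: "\<phi> \<in> T" "\<phi>' \<in> T" "a \<in> {1..d} - (D \<union> N)"
      have pS: "\<phi> \<in> S" "\<phi>' \<in> S" using p T by auto
      have a: "a \<in> core (f \<circ> \<phi>)" "a \<in> core (f \<circ> \<phi>')" using D(2)[OF pS(1)] D(2)[OF pS(2)] p(3) by auto
      show "dist (\<phi> a) (\<phi>' a) < \<epsilon>"
      proof (rule decode)
        show "\<phi> a \<in> X" "\<phi>' a \<in> X" 
          using funcset_mem[OF subsetD[OF S(2) pS(1)]] funcset_mem[OF subsetD[OF S(2) pS(2)]] p(3)
          by blast+
        fix s assume s: "s \<in> E'"
        then have sB: "s \<in> B" "s \<in> carrier G" using E'(2) B_carrier by auto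
        have away: "\<sigma> (inv k) (\<sigma> s a) \<notin> W" if "k \<in> A" for k using p(3) s that by (auto simp: N_def)
        have "dist (\<Psi> \<phi> W (\<sigma> s a)) (\<alpha> s (f (\<phi> a))) \<le> 2 * e"
          using transplant_away[OF tr[OF pS(1) W] f\<phi>[OF pS(1)] a(1) sB(1) away] by simp
        moreover have "dist (\<Psi> \<phi>' W (\<sigma> s a)) (\<alpha> s (f (\<phi>' a))) \<le> 2 * e"
          using transplant_away[OF tr[OF pS(2) W] f\<phi>[OF pS(2)] a(2) sB(1) away] by simp
        moreover have "dist (\<Psi> \<phi> W (\<sigma> s a)) (\<Psi> \<phi>' W (\<sigma> s a)) < 2 * \<epsilon>"
          using close[OF p(1,2)] vertex_closed[OF sB(2)] p(3) by blast
        ultimately show "dist (\<alpha> s (f (\<phi> a))) (\<alpha> s (f (\<phi>' a))) \<le> c"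
          using scales
            dist_triangle[of "\<alpha> s (f (\<phi> a))" "\<alpha> s (f (\<phi>' a))" "\<Psi> \<phi> W (\<sigma> s a)"]
            dist_triangle[of "\<Psi> \<phi> W (\<sigma> s a)" "\<alpha> s (f (\<phi>' a))" "\<Psi> \<phi>' W (\<sigma> s a)"]
          by (simp add: dist_commute)
      qed
    qed
    also have "\<dots> \<le> M ^ (card D + card E' * card A * card W)"
      using N card_Un_le[of D N] cls(1) by (intro power_increasing) auto
    finally have "real (card T) \<le> real (M ^ (card D + card E' * card A * card W))"
      by (simp only: of_nat_le_iff)
    then show ?thesis by (simp add: power_add power_mult)
  qed
  obtain T where T: "finite T" "T \<subseteq> {\<Psi> \<phi> W |\<phi> W. \<phi> \<in> S \<and> W \<subseteq> V}"
    "pairwise (\<lambda>p q. rho_inf d p q \<ge> \<epsilon>) T"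
    "real (card S) * (1 + 1 / real M ^ (card E' * card A)) ^ card V \<le> real M ^ card D * real (card T)"
    by (rule separated_family_card[OF \<open>d > 0\<close> \<open>0 < \<epsilon>\<close> S(1) finV _ _ determine multiplicity])
      (use cls(1) in auto)
  show thesis
  proof (rule that[OF T(1) _ T(3,4)])
    show "\<forall>p\<in>T. \<exists>\<phi>\<in>S. \<exists>W\<subseteq>V. transplant (f \<circ> \<phi>) W p" using T(2) tr by blast
  qed
qed

end


section \<open>Accurate vertices of sofic maps\<close>

lemma card_hamming_dist:
  "d > 0 \<Longrightarrow> real (card {a \<in> {1..d}. p a \<noteq> q a}) = hamming_dist d p q * real d"
  by (simp add: hamming_dist_def)

lemma sofic_eventually_multiplicative:
  assumes "sofic_approximation G d \<sigma>" "s \<in> carrier G" "t \<in> carrier G" "\<beta> > 0"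
  shows "\<forall>\<^sub>F j in sequentially.
    real (card {a \<in> {1..d j}. \<sigma> j s (\<sigma> j t a) \<noteq> \<sigma> j (s \<otimes>\<^bsub>G\<^esub> t) a}) \<le> \<beta> * real (d j)"
proof -
  have "(\<lambda>j. hamming_dist (d j) (\<sigma> j s \<circ> \<sigma> j t) (\<sigma> j (s \<otimes>\<^bsub>G\<^esub> t))) \<longlonglongrightarrow> 0"
    and pos: "d j > 0" for j
    using assms unfolding sofic_approximation_def by auto
  then have "\<forall>\<^sub>F j in sequentially. hamming_dist (d j) (\<sigma> j s \<circ> \<sigma> j t) (\<sigma> j (s \<otimes>\<^bsub>G\<^esub> t)) < \<beta>"
    using \<open>\<beta> > 0\<close> order_tendstoD(2) by blast
  then show ?thesis
  proof eventually_elim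
    case (elim j)
    then show ?case
      using card_hamming_dist[OF pos, of j "\<sigma> j s \<circ> \<sigma> j t" "\<sigma> j (s \<otimes>\<^bsub>G\<^esub> t)"] by (simp add: mult_right_mono)
  qed
qed

lemma sofic_eventually_free:
  assumes "sofic_approximation G d \<sigma>" "s \<in> carrier G" "t \<in> carrier G" "s \<noteq> t" "\<beta> > 0"
  shows "\<forall>\<^sub>F j in sequentially.
    real (card {a \<in> {1..d j}. \<sigma> j s a = \<sigma> j t a}) \<le> \<beta> * real (d j)"
proof -
  have "(\<lambda>j. hamming_dist (d j) (\<sigma> j s) (\<sigma> j t)) \<longlonglongrightarrow> 1" and pos: "d j > 0" for j
    using assms unfolding sofic_approximation_def by auto
  then have "\<forall>\<^sub>F j in sequentially. hamming_dist (d j) (\<sigma> j s) (\<sigma> j t) > 1 - \<beta>"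
    using \<open>\<beta> > 0\<close> order_tendstoD(1)[of _ 1 sequentially "1 - \<beta>"] by simp
  then show ?thesis
  proof eventually_elim
    case (elim j)
    have "card {1..d j} = card {a \<in> {1..d j}. \<sigma> j s a = \<sigma> j t a} + card {a \<in> {1..d j}. \<sigma> j s a \<noteq> \<sigma> j t a}"
      using card_Int_Diff[of "{1..d j}" "{a. \<sigma> j s a = \<sigma> j t a}"]
      by (simp add: Int_def set_diff_eq)
    moreover have "(1 - \<beta>) * real (d j) \<le> hamming_dist (d j) (\<sigma> j s) (\<sigma> j t) * real (d j)"
      using elim by (intro mult_right_mono) auto
    ultimately show ?case
      using card_hamming_dist[OF pos, of j "\<sigma> j s" "\<sigma> j t"] by (simp add: algebra_simps)
  qed
qed

lemma rho2_chebyshev: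
  assumes "d > 0" "\<tau> > 0" "rho2 d \<phi> \<psi> < \<tau> * sqrt \<beta>" "\<beta> > 0"
  shows "real (card {a \<in> {1..d}. dist (\<phi> a) (\<psi> a) \<ge> \<tau>}) \<le> \<beta> * real d"
proof -
  let ?H = "{a \<in> {1..d}. dist (\<phi> a) (\<psi> a) \<ge> \<tau>}"
  let ?s = "\<Sum>a\<in>{1..d}. (dist (\<phi> a) (\<psi> a))\<^sup>2"
  have nn: "0 \<le> ?s / real d" by (intro divide_nonneg_nonneg sum_nonneg) auto
  then have "?s / real d = (rho2 d \<phi> \<psi>)\<^sup>2" by (simp add: rho2_def)
  also have "\<dots> \<le> (\<tau> * sqrt \<beta>)\<^sup>2"
    using assms(3) nn by (intro power_mono) (auto simp: rho2_def)
  also have "\<dots> = \<tau>\<^sup>2 * \<beta>" using \<open>\<beta> > 0\<close> by (simp add: power_mult_distrib)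
  finally have s: "?s \<le> \<tau>\<^sup>2 * \<beta> * real d" using \<open>d > 0\<close> by (simp add: field_simps)
  have "real (card ?H) * \<tau>\<^sup>2 = (\<Sum>a\<in>?H. \<tau>\<^sup>2)" by simp
  also have "\<dots> \<le> (\<Sum>a\<in>?H. (dist (\<phi> a) (\<psi> a))\<^sup>2)"
    using \<open>\<tau> > 0\<close> by (intro sum_mono power_mono) auto
  also have "\<dots> \<le> ?s" by (intro sum_mono2) auto
  also note s
  finally have "\<tau>\<^sup>2 * real (card ?H) \<le> \<tau>\<^sup>2 * (\<beta> * real d)" by (simp add: algebra_simps)
  then show ?thesis using \<open>\<tau> > 0\<close> by simp
qed

lemma card_UN_le_real:
  fixes c :: real
  assumes "finite I" "\<And>i. i \<in> I \<Longrightarrow> real (card (H i)) \<le> c"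
  shows "real (card (\<Union>i\<in>I. H i)) \<le> real (card I) * c"
proof -
  have "real (card (\<Union>i\<in>I. H i)) \<le> (\<Sum>i\<in>I. real (card (H i)))"
    using card_UN_le[OF assms(1), of H] by (metis of_nat_le_iff of_nat_sum)
  also have "\<dots> \<le> real (card I) * c" using sum_bounded_above[of I "\<lambda>i. real (card (H i))" c] assms(2) by simp
  finally show ?thesis .
qed

context dynamical_system
begin

text \<open>
  A vertex that is not good fails one of \<open>2 |B|\<^sup>2 + |B|\<close> conditions, each violated at no more than
  \<open>c\<close> vertices. A vertex outside the core is itself not good or is mapped by one of \<open>|B|\<close>
  permutations to a vertex that is not good.
\<close>

lemma card_noncore_le:
  assumes perm: "\<And>s. s \<in> B \<Longrightarrow> \<sigma> s permutes {1..d}" and "finite B" "c \<ge> 0"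
    and comp: "\<And>s t. s \<in> B \<Longrightarrow> t \<in> B \<Longrightarrow>
      real (card {a \<in> {1..d}. \<sigma> s (\<sigma> t a) \<noteq> \<sigma> (s \<otimes> t) a}) \<le> c"
    and free: "\<And>s t. s \<in> B \<Longrightarrow> t \<in> B \<Longrightarrow> s \<noteq> t \<Longrightarrow>
      real (card {a \<in> {1..d}. \<sigma> s a = \<sigma> t a}) \<le> c"
    and equi: "\<And>t. t \<in> B \<Longrightarrow> real (card {a \<in> {1..d}. \<exists>s\<in>B.
      dist (\<alpha> s (\<psi> (\<sigma> t a))) (\<alpha> s (\<alpha> t (\<psi> a))) > \<tau>}) \<le> c"
  shows "real (card ({1..d} - core_vertices B \<tau> d \<sigma> \<psi>))
    \<le> real (card B + 1) * (real (2 * card B * card B + card B) * c)"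
proof -
  define Bad where "Bad = {1..d} - good_vertices B \<tau> d \<sigma> \<psi>"
  let ?H1 = "\<Union>p\<in>B \<times> B. {a \<in> {1..d}. \<sigma> (fst p) (\<sigma> (snd p) a) \<noteq> \<sigma> (fst p \<otimes> snd p) a}"
  let ?H2 = "\<Union>p\<in>B \<times> B. {a \<in> {1..d}. fst p \<noteq> snd p \<and> \<sigma> (fst p) a = \<sigma> (snd p) a}"
  let ?H3 = "\<Union>t\<in>B. {a \<in> {1..d}. \<exists>s\<in>B. dist (\<alpha> s (\<psi> (\<sigma> t a))) (\<alpha> s (\<alpha> t (\<psi> a))) > \<tau>}"
  have "Bad \<subseteq> ?H1 \<union> (?H2 \<union> ?H3)" 
  proof (rule subsetI, rule ccontr)
    fix a assume a: "a \<in> Bad" "a \<notin> ?H1 \<union> (?H2 \<union> ?H3)"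
    then have "a \<in> {1..d}" by (simp add: Bad_def)
    then have "\<sigma> s (\<sigma> t a) = \<sigma> (s \<otimes> t) a \<and> (s \<noteq> t \<longrightarrow> \<sigma> s a \<noteq> \<sigma> t a) \<and>
        dist (\<alpha> s (\<psi> (\<sigma> t a))) (\<alpha> s (\<alpha> t (\<psi> a))) \<le> \<tau>" if "s \<in> B" "t \<in> B" for s t
      using a(2) that by (auto simp: not_less)
    then show False using a(1) \<open>a \<in> {1..d}\<close> unfolding Bad_def good_vertices_def by blast
  qed
  then have "card Bad \<le> card (?H1 \<union> (?H2 \<union> ?H3))" using \<open>finite B\<close> by (intro card_mono) auto
  also have "\<dots> \<le> card ?H1 + (card ?H2 + card ?H3)"
    using card_Un_le[of ?H1 "?H2 \<union> ?H3"] card_Un_le[of ?H2 ?H3] by linarith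
  finally have "real (card Bad) \<le> real (card ?H1) + (real (card ?H2) + real (card ?H3))"
    by (simp only: flip: of_nat_add of_nat_le_iff)
  moreover have "real (card ?H1) \<le> real (card (B \<times> B)) * c"
    using comp \<open>finite B\<close> by (intro card_UN_le_real) auto
  moreover have "real (card ?H2) \<le> real (card (B \<times> B)) * c"
  proof (rule card_UN_le_real)
    fix p assume "p \<in> B \<times> B"
    then show "real (card {a \<in> {1..d}. fst p \<noteq> snd p \<and> \<sigma> (fst p) a = \<sigma> (snd p) a}) \<le> c"
      using free[of "fst p" "snd p"] \<open>c \<ge> 0\<close> by (cases "fst p = snd p") auto
  qed (use \<open>finite B\<close> in auto)
  moreover have "real (card ?H3) \<le> real (card B) * c"
    using equi \<open>finite B\<close> by (intro card_UN_le_real) auto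
  ultimately have bad: "real (card Bad) \<le> real (2 * card B * card B + card B) * c"
    by (simp add: card_cartesian_product algebra_simps)
  have finBad: "finite Bad" by (simp add: Bad_def)
  have "{1..d} - core_vertices B \<tau> d \<sigma> \<psi> \<subseteq> Bad \<union> (\<Union>t\<in>B. {a \<in> {1..d}. \<sigma> t a \<in> Bad})"
    unfolding core_vertices_def Bad_def using permutes_in_image[OF perm] by auto
  then have "card ({1..d} - core_vertices B \<tau> d \<sigma> \<psi>) \<le> card (Bad \<union> (\<Union>t\<in>B. {a \<in> {1..d}. \<sigma> t a \<in> Bad}))"
    using \<open>finite B\<close> finBad by (intro card_mono) auto
  also have "\<dots> \<le> card Bad + card (\<Union>t\<in>B. {a \<in> {1..d}. \<sigma> t a \<in> Bad})" by (rule card_Un_le)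
  finally have "real (card ({1..d} - core_vertices B \<tau> d \<sigma> \<psi>))
      \<le> real (card Bad) + real (card (\<Union>t\<in>B. {a \<in> {1..d}. \<sigma> t a \<in> Bad}))"
    by (simp only: flip: of_nat_add of_nat_le_iff)
  also have "real (card (\<Union>t\<in>B. {a \<in> {1..d}. \<sigma> t a \<in> Bad})) \<le> real (card B) * real (card Bad)"
  proof (rule card_UN_le_real[OF \<open>finite B\<close>])
    fix t assume "t \<in> B"
    then have "inj (\<sigma> t)" using perm permutes_inj by blast
    then show "real (card {a \<in> {1..d}. \<sigma> t a \<in> Bad}) \<le> real (card Bad)"
      by (simp only: of_nat_le_iff, intro card_preimage_le[OF inj_on_subset finBad]) auto
  qed
  finally have "real (card ({1..d} - core_vertices B \<tau> d \<sigma> \<psi>)) \<le> real (card B + 1) * real (card Bad)"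
    by (simp add: algebra_simps)
  also have "\<dots> \<le> real (card B + 1) * (real (2 * card B * card B + card B) * c)"
    using bad by (intro mult_left_mono) auto
  finally show ?thesis .
qed

lemma eventually_few_noncore_vertices:
  assumes sofic: "sofic_approximation G d \<sigma>" and f: "endomorphism G X \<alpha> f"
    and B: "finite B" "B \<subseteq> carrier G" and "\<tau> > 0" "\<gamma> > 0"
  obtains \<delta> where "\<delta> > 0" "\<forall>\<^sub>F j in sequentially. \<forall>\<phi>\<in>sofic_maps X \<alpha> B \<delta> (d j) (\<sigma> j).
    real (card ({1..d j} - core_vertices B \<tau> (d j) (\<sigma> j) (f \<circ> \<phi>))) \<le> \<gamma> * real (d j)"
proof -
  have fX: "f \<in> X \<rightarrow> X" "continuous_on X f"
    and equi: "\<And>g x. g \<in> carrier G \<Longrightarrow> x \<in> X \<Longrightarrow> f (\<alpha> g x) = \<alpha> g (f x)"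
    using f by (auto simp: endomorphism_def)
  obtain \<eta> where \<eta>: "\<eta> > 0"
    "\<And>s x y. s \<in> B \<Longrightarrow> x \<in> X \<Longrightarrow> y \<in> X \<Longrightarrow> dist x y < \<eta> \<Longrightarrow> dist (\<alpha> s (f x)) (\<alpha> s (f y)) < \<tau>"
    using uniform_continuity_finite[OF B fX(2,1) \<open>\<tau> > 0\<close>] by blast
  define n where "n = (card B + 1) * (2 * card B * card B + card B) + 1"
  define \<beta> where "\<beta> = \<gamma> / real n"
  have "n > 0" by (simp add: n_def)
  then have \<beta>: "\<beta> > 0" "real n * \<beta> = \<gamma>" using \<open>\<gamma> > 0\<close> by (auto simp: \<beta>_def)
  have pos: "d j > 0" and perm: "s \<in> carrier G \<Longrightarrow> \<sigma> j s permutes {1..d j}" for j s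
    using sofic by (auto simp: sofic_approximation_def)
  have "\<forall>\<^sub>F j in sequentially. \<forall>s\<in>B. \<forall>t\<in>B.
      real (card {a \<in> {1..d j}. \<sigma> j s (\<sigma> j t a) \<noteq> \<sigma> j (s \<otimes> t) a}) \<le> \<beta> * real (d j)"
    using sofic_eventually_multiplicative[OF sofic _ _ \<beta>(1)] B
    by (intro eventually_ball_finite ballI) auto
  moreover have "\<forall>\<^sub>F j in sequentially. \<forall>s\<in>B. \<forall>t\<in>B. s \<noteq> t \<longrightarrow>
      real (card {a \<in> {1..d j}. \<sigma> j s a = \<sigma> j t a}) \<le> \<beta> * real (d j)"
  proof (intro eventually_ball_finite B ballI)
    fix s t assume "s \<in> B" "t \<in> B"
    then show "\<forall>\<^sub>F j in sequentially. s \<noteq> t \<longrightarrow>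
        real (card {a \<in> {1..d j}. \<sigma> j s a = \<sigma> j t a}) \<le> \<beta> * real (d j)"
      using sofic_eventually_free[OF sofic _ _ _ \<beta>(1), of s t] B(2) by (cases "s = t") auto
  qed
  ultimately have "\<forall>\<^sub>F j in sequentially. \<forall>\<phi>\<in>sofic_maps X \<alpha> B (\<eta> * sqrt \<beta>) (d j) (\<sigma> j).
    real (card ({1..d j} - core_vertices B \<tau> (d j) (\<sigma> j) (f \<circ> \<phi>))) \<le> \<gamma> * real (d j)"
  proof eventually_elim
    case (elim j)
    show ?case
    proof
      fix \<phi> assume \<phi>: "\<phi> \<in> sofic_maps X \<alpha> B (\<eta> * sqrt \<beta>) (d j) (\<sigma> j)"
      have \<phi>X: "\<phi> a \<in> X" if "a \<in> {1..d j}" for a using \<phi> that by (auto simp: sofic_maps_def)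
      have "real (card ({1..d j} - core_vertices B \<tau> (d j) (\<sigma> j) (f \<circ> \<phi>)))
          \<le> real (card B + 1) * (real (2 * card B * card B + card B) * (\<beta> * real (d j)))"
      proof (rule card_noncore_le)
        fix t assume t: "t \<in> B"
        then have tG: "t \<in> carrier G" using B by blast
        show "\<sigma> j t permutes {1..d j}" using perm tG .
        let ?far = "{a \<in> {1..d j}. \<eta> \<le> dist ((\<phi> \<circ> \<sigma> j t) a) (\<alpha> t (\<phi> a))}"
        have "{a \<in> {1..d j}. \<exists>s\<in>B. dist (\<alpha> s ((f \<circ> \<phi>) (\<sigma> j t a))) (\<alpha> s (\<alpha> t ((f \<circ> \<phi>) a))) > \<tau>} \<subseteq> ?far"
        proof
          fix a assume "a \<in> {a \<in> {1..d j}. \<exists>s\<in>B.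
            dist (\<alpha> s ((f \<circ> \<phi>) (\<sigma> j t a))) (\<alpha> s (\<alpha> t ((f \<circ> \<phi>) a))) > \<tau>}"
          then obtain s where a: "a \<in> {1..d j}" "s \<in> B"
            "dist (\<alpha> s ((f \<circ> \<phi>) (\<sigma> j t a))) (\<alpha> s (\<alpha> t ((f \<circ> \<phi>) a))) > \<tau>" by blast
          have "\<sigma> j t a \<in> {1..d j}" using permutes_in_image[OF perm[OF tG]] a(1) by blast
          then have "dist (\<phi> (\<sigma> j t a)) (\<alpha> t (\<phi> a)) < \<eta> \<Longrightarrow>
              dist (\<alpha> s (f (\<phi> (\<sigma> j t a)))) (\<alpha> s (f (\<alpha> t (\<phi> a)))) < \<tau>"
            using a(1,2) \<phi>X act_closed[OF tG] by (intro \<eta>(2)) auto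
          then show "a \<in> ?far" using a(1,3) equi[OF tG \<phi>X[OF a(1)]] by force
        qed
        then have "real (card {a \<in> {1..d j}. \<exists>s\<in>B.
            dist (\<alpha> s ((f \<circ> \<phi>) (\<sigma> j t a))) (\<alpha> s (\<alpha> t ((f \<circ> \<phi>) a))) > \<tau>}) \<le> real (card ?far)"
          by (simp only: of_nat_le_iff) (rule card_mono, auto)
        also have "\<dots> \<le> \<beta> * real (d j)"
          using rho2_chebyshev[OF pos \<eta>(1) _ \<beta>(1), of j "\<phi> \<circ> \<sigma> j t" "\<lambda>a. \<alpha> t (\<phi> a)"] \<phi> t
          unfolding sofic_maps_def by blast
        finally show "real (card {a \<in> {1..d j}. \<exists>s\<in>B.
            dist (\<alpha> s ((f \<circ> \<phi>) (\<sigma> j t a))) (\<alpha> s (\<alpha> t ((f \<circ> \<phi>) a))) > \<tau>}) \<le> \<beta> * real (d j)" .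
      qed (use elim B \<beta>(1) in auto)
      also have "\<dots> \<le> real n * (\<beta> * real (d j))"
        using \<beta>(1) by (simp add: n_def algebra_simps)
      also have "\<dots> = \<gamma> * real (d j)" using \<beta>(2) by (simp flip: mult.assoc)
      finally show "real (card ({1..d j} - core_vertices B \<tau> (d j) (\<sigma> j) (f \<circ> \<phi>))) \<le> \<gamma> * real (d j)" .
    qed
  qed
  then show thesis using \<eta>(1) \<beta>(1) by (intro that[of "\<eta> * sqrt \<beta>"]) auto
qed

end


section \<open>Exponential estimates\<close>

text \<open>
  Weighting a subset \<open>D\<close> by \<open>\<mu> ^ |D|\<close> gives total weight \<open>(1 + \<mu>) ^ |U|\<close>, and each small subset has
  weight at least \<open>\<mu> powr r\<close>.
\<close>

lemma card_small_subsets_le: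
  fixes r \<mu> :: real
  assumes "finite U" "0 < \<mu>" "\<mu> \<le> 1"
  shows "real (card {D. D \<subseteq> U \<and> real (card D) \<le> r}) \<le> exp (\<mu> * real (card U) + r * ln (1 / \<mu>))"
proof -
  let ?\<D> = "{D. D \<subseteq> U \<and> real (card D) \<le> r}"
  have "exp (- (r * ln (1 / \<mu>))) \<le> \<mu> ^ card D" if "D \<in> ?\<D>" for D
  proof -
    have "real (card D) * ln (1 / \<mu>) \<le> r * ln (1 / \<mu>)"
      using that assms by (intro mult_right_mono) auto
    then have "exp (- (r * ln (1 / \<mu>))) \<le> exp (real (card D) * ln \<mu>)"
      using \<open>0 < \<mu>\<close> by (simp add: ln_div)
    then show ?thesis using \<open>0 < \<mu>\<close> by (simp add: exp_of_nat_mult)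
  qed
  then have "(\<Sum>D\<in>?\<D>. exp (- (r * ln (1 / \<mu>)))) \<le> (\<Sum>D\<in>?\<D>. \<mu> ^ card D)"
    by (intro sum_mono) auto
  also have "\<dots> \<le> (\<Sum>D\<in>Pow U. \<mu> ^ card D)" using assms by (intro sum_mono2) auto
  also have "\<dots> = (1 + \<mu>) ^ card U" by (rule sum_Pow_power_card[OF assms(1)])
  also have "\<dots> \<le> exp \<mu> ^ card U" using assms by (intro power_mono) (auto simp: exp_ge_add_one_self)
  also have "\<dots> = exp (\<mu> * real (card U))" by (simp flip: exp_of_nat2_mult)
  finally have "real (card ?\<D>) * exp (- (r * ln (1 / \<mu>))) \<le> exp (\<mu> * real (card U))" by simp
  then show ?thesis by (simp add: exp_add exp_minus field_simps)
qed

lemma small_rates: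
  fixes b M \<beta> :: real
  assumes "b > 0" "M \<ge> 1" "\<beta> > 0"
  obtains \<gamma> \<mu> where "0 < \<gamma>" "\<gamma> \<le> 1 / 2" "\<gamma> \<le> \<beta>" "0 < \<mu>" "\<mu> \<le> 1"
    "\<mu> + \<gamma> * ln (1 / \<mu>) + \<gamma> * ln M \<le> b"
proof -
  define \<mu> where "\<mu> = min 1 (b / 2)"
  define \<gamma> where "\<gamma> = min (1 / 2) (min \<beta> (b / (2 * (ln (1 / \<mu>) + ln M + 1))))"
  have \<mu>: "0 < \<mu>" "\<mu> \<le> 1" "\<mu> \<le> b / 2" using assms by (auto simp: \<mu>_def)
  have pos: "0 \<le> ln (1 / \<mu>)" "0 \<le> ln M" using \<mu> assms by auto
  then have "ln (1 / \<mu>) + ln M + 1 > 0" by linarith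
  moreover have "\<gamma> \<le> b / (2 * (ln (1 / \<mu>) + ln M + 1))" by (simp add: \<gamma>_def)
  ultimately have "\<gamma> * (ln (1 / \<mu>) + ln M + 1) \<le> b / 2" by (simp add: field_simps)
  moreover have "\<gamma> > 0" using assms \<open>ln (1 / \<mu>) + ln M + 1 > 0\<close> by (simp add: \<gamma>_def)
  ultimately have "\<mu> + \<gamma> * ln (1 / \<mu>) + \<gamma> * ln M \<le> b" using \<mu> by (simp add: algebra_simps)
  moreover have "\<gamma> \<le> 1 / 2" "\<gamma> \<le> \<beta>" unfolding \<gamma>_def by linarith+
  ultimately show thesis using \<mu>(1,2) \<open>\<gamma> > 0\<close> by (intro that)
qed

lemma pigeonhole_fibre:
  fixes S :: "'a set" and g :: "'a \<Rightarrow> 'b"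
  assumes "finite S" "finite I" "g ` S \<subseteq> I" "S \<noteq> {}"
  obtains i where "i \<in> I" "card S \<le> card I * card {x \<in> S. g x = i}"
proof -
  have "\<exists>i\<in>I. card S \<le> card I * card {x \<in> S. g x = i}"
  proof (rule ccontr)
    assume *: "\<not> ?thesis"
    have less: "card I * card {x \<in> S. g x = i} < card S" if "i \<in> I" for i
      using that * by (meson not_le)
    have "I \<noteq> {}" using assms by blast
    have "card S = (\<Sum>i\<in>I. card {x \<in> S. g x = i})"
      using sum.group[OF assms(1-3), of "\<lambda>_. 1 :: nat"] by simp
    then have "card I * card S = (\<Sum>i\<in>I. card I * card {x \<in> S. g x = i})" by (simp add: sum_distrib_left)
    also have "\<dots> < (\<Sum>i\<in>I. card S)" using less \<open>I \<noteq> {}\<close> assms(2) by (intro sum_strict_mono)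
    finally show False by simp
  qed
  then show thesis using that by blast
qed

text \<open>
  The factor \<open>(1 + 1 / L) ^ v\<close> is at least \<open>exp (b d)\<close>. Fixing the inaccurate set \<open>D\<close> costs the
  number \<open>n\<close> of candidates for it, and ignorance of the values on \<open>D\<close> costs \<open>M ^ D\<close>; together these
  are at most \<open>exp (b d / 2)\<close>.
\<close>

lemma gain_exceeds_losses:
  fixes s s' t b \<gamma> \<mu> M L :: real and d D q v n :: nat
  assumes s: "s \<le> real n * s'" and s': "s' * (1 + 1 / L) ^ v \<le> M ^ D * t"
    and n: "real n \<le> exp (\<mu> * real d + \<gamma> * real d * ln (1 / \<mu>))"
    and D: "real D \<le> \<gamma> * real d" and v: "(1 - \<gamma>) * real d \<le> real q * real v"
    and "\<gamma> \<le> 1 / 2" "M \<ge> 1" "L > 0" "q > 0" "t \<ge> 0" "s' \<ge> 0"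
    and b: "b = ln (1 + 1 / L) / (2 * real q)"
    and rate: "\<mu> + \<gamma> * ln (1 / \<mu>) + \<gamma> * ln M \<le> b / 2"
  shows "s * exp (b / 2 * real d) \<le> t"
proof -
  have L: "1 + 1 / L > 1" using \<open>L > 0\<close> by simp
  have "b * real d \<le> v * ln (1 + 1 / L)"
  proof -
    have "real d / 2 \<le> (1 - \<gamma>) * d" using \<open>\<gamma> \<le> 1 / 2\<close> mult_right_mono[of "1 / 2" "1 - \<gamma>" "real d"] by simp
    then have "real d / (2 * q) \<le> v" using v \<open>q > 0\<close> by (simp add: field_simps)
    then have "real d / (2 * q) * ln (1 + 1 / L) \<le> v * ln (1 + 1 / L)"
      using L by (intro mult_right_mono) auto
    then show ?thesis by (simp add: b mult.commute)
  qed
  then have "exp (b * d) \<le> exp (v * ln (1 + 1 / L))" by simp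
  also have "\<dots> = (1 + 1 / L) ^ v" using L by (simp only: exp_of_nat_mult exp_ln less_trans[OF zero_less_one])
  finally have "s' * exp (b * d) \<le> s' * (1 + 1 / L) ^ v" using \<open>s' \<ge> 0\<close> by (intro mult_left_mono)
  also note s'
  also have "M ^ D * t \<le> exp (\<gamma> * d * ln M) * t"
  proof (rule mult_right_mono[OF _ \<open>t \<ge> 0\<close>])
    have "M ^ D = exp (D * ln M)" using \<open>M \<ge> 1\<close> by (simp add: exp_of_nat_mult)
    also have "\<dots> \<le> exp (\<gamma> * d * ln M)" using D \<open>M \<ge> 1\<close> by (simp add: mult_right_mono)
    finally show "M ^ D \<le> exp (\<gamma> * d * ln M)" .
  qed
  finally have s'2: "s' * exp (b * d) \<le> exp (\<gamma> * d * ln M) * t" .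
  have "s * exp (b * d) \<le> n * (s' * exp (b * d))" using s by (simp add: mult.assoc[symmetric] mult_right_mono)
  also have "\<dots> \<le> exp (\<mu> * d + \<gamma> * d * ln (1 / \<mu>)) * (exp (\<gamma> * d * ln M) * t)"
    using \<open>s' \<ge> 0\<close> by (intro mult_mono[OF n s'2]) auto
  also have "\<dots> = exp (d * (\<mu> + \<gamma> * ln (1 / \<mu>) + \<gamma> * ln M)) * t"
    by (simp add: exp_add algebra_simps)
  also have "\<dots> \<le> exp (d * (b / 2)) * t"
    using mult_left_mono[OF rate, of "real d"] \<open>t \<ge> 0\<close> by (intro mult_right_mono) auto
  finally have total: "s * exp (b * d) \<le> exp (d * (b / 2)) * t" .
  define x where "x = exp (b / 2 * d)"
  have "exp (b * d) = x * x" "exp (d * (b / 2)) = x" by (simp_all add: x_def mult.commute flip: exp_add)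
  then have "(s * x) * x \<le> t * x" using total by (simp add: algebra_simps)
  then have "s * x \<le> t" by (rule mult_right_le_imp_le) (simp add: x_def)
  then show ?thesis by (simp add: x_def)
qed


section \<open>Growth of the number of sofic maps\<close>

context dynamical_system
begin

text \<open>
  It is essential that \<open>\<kappa>\<close> is chosen before \<open>F\<close> and \<open>\<delta>\<close>. It depends on \<open>Q\<close>, which bounds the density
  of centres, and on \<open>L\<close>, hence only on the action, on \<open>c\<close>, on \<open>f\<close> and on \<open>x0\<close>. The pair \<open>(F, \<delta>)\<close>
  only affects the window \<open>B\<close> in which accuracy is required and the proportion \<open>\<gamma>\<close> of vertices where
  it may fail. Inaccurate vertices vary with \<open>\<phi>\<close>, whereas the centres must not; so the maps are
  first grouped by their inaccurate set \<open>D\<close>, and only the largest group is used.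
\<close>

lemma sofic_maps_count_increases:
  fixes c :: real
  assumes ws: "weak_specification G X \<alpha>" and markov: "strong_topological_Markov G X \<alpha>"
    and "c > 0" and sep: "\<forall>x\<in>X. \<forall>y\<in>X. x \<noteq> y \<longrightarrow> (\<exists>g\<in>carrier G. dist (\<alpha> g x) (\<alpha> g y) > c)"
    and f: "endomorphism G X \<alpha> f" "inj_on f X" and x0: "x0 \<in> X" "x0 \<notin> f ` X"
    and sofic: "sofic_approximation G d \<sigma>"
  obtains \<kappa> where "\<kappa> > 0" "\<forall>F \<delta>. finite F \<longrightarrow> F \<subseteq> carrier G \<longrightarrow> \<delta> > 0 \<longrightarrow>
    (\<exists>F' \<delta>'. finite F' \<and> F' \<noteq> {} \<and> F' \<subseteq> carrier G \<and> \<delta>' > 0 \<and>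
      (\<forall>\<^sub>F j in sequentially. \<forall>S. finite S \<longrightarrow> S \<subseteq> sofic_maps X \<alpha> F' \<delta>' (d j) (\<sigma> j) \<longrightarrow>
        pairwise (\<lambda>p q. rho_inf (d j) p q \<ge> c / 4) S \<longrightarrow>
        (\<exists>T. finite T \<and> T \<subseteq> sofic_maps X \<alpha> F \<delta> (d j) (\<sigma> j) \<and>
          pairwise (\<lambda>p q. rho_inf (d j) p q \<ge> c / 4) T \<and>
          real (card S) * exp (\<kappa> * real (d j)) \<le> real (card T))))"
proof -
  \<comment> \<open>Recovering \<open>\<phi>\<close> from a modified map compares two maps at distance below \<open>2 \<epsilon>\<close>, each with error
    \<open>2 e\<close>.\<close>
  define \<epsilon> where "\<epsilon> = c / 4"
  define e where "e = c / 16"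
  have scales: "0 < \<epsilon>" "0 < e" "2 * \<epsilon> + 4 * e \<le> c" "3 * e \<le> c"
    using \<open>c > 0\<close> by (auto simp: \<epsilon>_def e_def)
  have fX: "f \<in> X \<rightarrow> X" "continuous_on X f" using f(1) by (auto simp: endomorphism_def)
  have "open (- f ` X)"
    using compact_continuous_image[OF fX(2) compact_space] compact_imp_closed by blast
  then obtain \<eta> where "\<eta> > 0" "ball x0 \<eta> \<subseteq> - f ` X"
    using x0(2) open_contains_ball by (metis ComplI)
  then have \<eta>: "\<eta> > 0" "\<And>y. y \<in> f ` X \<Longrightarrow> \<eta> \<le> dist x0 y"
    by (auto simp: subset_iff not_less)
  obtain K where K: "finite K" "K \<subseteq> carrier G"
    and K_sep: "\<And>x y. x \<in> X \<Longrightarrow> y \<in> X \<Longrightarrow> (\<And>s. s \<in> K \<Longrightarrow> dist (\<alpha> s x) (\<alpha> s y) \<le> c) \<Longrightarrow> dist x y < \<eta>"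
    using expansive_finite_window[OF sep \<eta>(1)] by blast
  have missing: "\<exists>k\<in>K. dist (\<alpha> k x0) (\<alpha> k (f y)) > c" if "y \<in> X" for y
    using K_sep[of x0 "f y"] \<eta>(2)[of "f y"] x0(1) fX(1) that by (force simp: not_le)
  obtain A C Q \<theta> P where surgery: "pattern_surgery G X \<alpha> x0 K A C Q \<theta> e P"
    using pattern_surgery_exists[OF ws markov x0(1) K scales(2)] by blast
  interpret pattern_surgery G X \<alpha> x0 K A C Q \<theta> e P by (rule surgery)
  obtain E' where E': "finite E'" "E' \<subseteq> carrier G"
    and decode: "\<And>x y. x \<in> X \<Longrightarrow> y \<in> X \<Longrightarrow>
      (\<And>s. s \<in> E' \<Longrightarrow> dist (\<alpha> s (f x)) (\<alpha> s (f y)) \<le> c) \<Longrightarrow> dist x y < \<epsilon>"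
    using embedding_finite_window[OF sep fX f(2) scales(1)] by blast
  obtain M :: nat and cls where cls: "M > 0" "\<And>x. x \<in> X \<Longrightarrow> cls x < M"
    "\<And>x y. x \<in> X \<Longrightarrow> y \<in> X \<Longrightarrow> cls x = cls y \<Longrightarrow> dist x y < \<epsilon>"
    using compact_finite_partition[OF compact_space scales(1)] by metis
  have "bounded X" using compact_space compact_imp_bounded by blast
  then obtain \<Delta> where \<Delta>: "\<And>x y. x \<in> X \<Longrightarrow> y \<in> X \<Longrightarrow> dist x y \<le> \<Delta>"
    using bounded_two_points by metis
  define L where "L = real M ^ (card E' * card A)"
  define q where "q = 2 * card Q + 1"
  define b where "b = ln (1 + 1 / L) / (2 * real q)"
  have L: "L > 0" using cls(1) by (simp add: L_def)
  then have "ln (1 + 1 / L) > 0" by (intro ln_gt_zero) simp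
  then have b: "b > 0" unfolding b_def q_def by (intro divide_pos_pos) auto
  have pos: "d j > 0" and perm: "s \<in> carrier G \<Longrightarrow> \<sigma> j s permutes {1..d j}" for j s
    using sofic by (auto simp: sofic_approximation_def)
  have "\<exists>F' \<delta>'. finite F' \<and> F' \<noteq> {} \<and> F' \<subseteq> carrier G \<and> \<delta>' > 0 \<and>
      (\<forall>\<^sub>F j in sequentially. \<forall>S. finite S \<longrightarrow> S \<subseteq> sofic_maps X \<alpha> F' \<delta>' (d j) (\<sigma> j) \<longrightarrow>
        pairwise (\<lambda>p q. rho_inf (d j) p q \<ge> \<epsilon>) S \<longrightarrow>
        (\<exists>T. finite T \<and> T \<subseteq> sofic_maps X \<alpha> F \<delta> (d j) (\<sigma> j) \<and>
          pairwise (\<lambda>p q. rho_inf (d j) p q \<ge> \<epsilon>) T \<and>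
          real (card S) * exp (b / 2 * real (d j)) \<le> real (card T)))"
    if F: "finite F" "F \<subseteq> carrier G" and "\<delta> > 0" for F and \<delta> :: real
  proof -
    have "\<delta> / 2 > 0" using \<open>\<delta> > 0\<close> by simp
    then obtain E where E: "finite E" "E \<subseteq> carrier G"
      and E_sep: "\<And>x y. x \<in> X \<Longrightarrow> y \<in> X \<Longrightarrow> (\<And>u. u \<in> E \<Longrightarrow> dist (\<alpha> u x) (\<alpha> u y) \<le> c) \<Longrightarrow> dist x y < \<delta> / 2"
      using expansive_finite_window[OF sep] by blast
    \<comment> \<open>If \<open>u = k r\<close> or \<open>u t = k r\<close> is in the patch of the site \<open>r\<close>, then \<open>r\<close> is of the second or
      third form.\<close>
    define R where "R = (\<lambda>k. inv k) ` A \<union> (\<lambda>(k, u). inv k \<otimes> u) ` (A \<times> E) \<union>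
      (\<lambda>(k, u, t). inv k \<otimes> u \<otimes> t) ` (A \<times> E \<times> F)"
    define B where "B = {\<one>} \<union> A \<union> C \<union> Q \<union> R \<union> E' \<union> E \<union> F"
    have R: "finite R" "R \<subseteq> carrier G"
      using finite_A A_carrier E F by (auto simp: R_def subset_iff)
    have B: "finite B" "B \<subseteq> carrier G" "B \<noteq> {}"
      using finite_A finite_C finite_Q A_carrier C_carrier Q_carrier R E E' F by (auto simp: B_def)
    have window: "inv k \<otimes> u \<in> R \<and> inv k \<otimes> u \<otimes> t \<in> R" if "k \<in> A" "u \<in> E" "t \<in> F" for k u t
      using that by (force simp: R_def)
    have "\<delta>\<^sup>2 / (2 * (\<Delta>\<^sup>2 + 1)) > 0" using \<open>\<delta> > 0\<close> by (simp add: add_nonneg_pos)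
    moreover have "b / 2 > 0" "real M \<ge> 1" using b cls(1) by auto
    ultimately obtain \<gamma> \<mu> where rates: "0 < \<gamma>" "\<gamma> \<le> 1 / 2" "\<gamma> \<le> \<delta>\<^sup>2 / (2 * (\<Delta>\<^sup>2 + 1))" "0 < \<mu>" "\<mu> \<le> 1"
      "\<mu> + \<gamma> * ln (1 / \<mu>) + \<gamma> * ln (real M) \<le> b / 2"
      using small_rates by metis
    have "2 * (\<Delta>\<^sup>2 + 1) > 0" by (simp add: add_nonneg_pos)
    then have "\<gamma> * (2 * (\<Delta>\<^sup>2 + 1)) \<le> \<delta>\<^sup>2" using rates(3) by (simp only: pos_le_divide_eq)
    then have \<gamma>\<Delta>: "\<gamma> * \<Delta>\<^sup>2 \<le> \<delta>\<^sup>2 / 2" using rates(1) by (simp add: algebra_simps)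
    have "min \<theta> e > 0" using theta_pos e_pos by simp
    obtain \<delta>' where \<delta>': "\<delta>' > 0" and few: "\<forall>\<^sub>F j in sequentially. \<forall>\<phi>\<in>sofic_maps X \<alpha> B \<delta>' (d j) (\<sigma> j).
      real (card ({1..d j} - core_vertices B (min \<theta> e) (d j) (\<sigma> j) (f \<circ> \<phi>))) \<le> \<gamma> * real (d j)"
      using eventually_few_noncore_vertices[OF sofic f(1) B(1,2) \<open>min \<theta> e > 0\<close> rates(1)] by blast
    have "\<forall>\<^sub>F j in sequentially. \<forall>S. finite S \<longrightarrow> S \<subseteq> sofic_maps X \<alpha> B \<delta>' (d j) (\<sigma> j) \<longrightarrow>
        pairwise (\<lambda>p q. rho_inf (d j) p q \<ge> \<epsilon>) S \<longrightarrow>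
        (\<exists>T. finite T \<and> T \<subseteq> sofic_maps X \<alpha> F \<delta> (d j) (\<sigma> j) \<and>
          pairwise (\<lambda>p q. rho_inf (d j) p q \<ge> \<epsilon>) T \<and>
          real (card S) * exp (b / 2 * real (d j)) \<le> real (card T))"
      using few
    proof (eventually_elim, intro allI impI)
      fix j S
      assume few: "\<forall>\<phi>\<in>sofic_maps X \<alpha> B \<delta>' (d j) (\<sigma> j).
          real (card ({1..d j} - core_vertices B (min \<theta> e) (d j) (\<sigma> j) (f \<circ> \<phi>))) \<le> \<gamma> * real (d j)"
        and S: "finite S" "S \<subseteq> sofic_maps X \<alpha> B \<delta>' (d j) (\<sigma> j)"
          "pairwise (\<lambda>p q. rho_inf (d j) p q \<ge> \<epsilon>) S"
      define bad where "bad \<phi> = {1..d j} - core_vertices B (min \<theta> e) (d j) (\<sigma> j) (f \<circ> \<phi>)" for \<phi>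
      define \<D> where "\<D> = {D. D \<subseteq> {1..d j} \<and> real (card D) \<le> \<gamma> * real (d j)}"
      show "\<exists>T. finite T \<and> T \<subseteq> sofic_maps X \<alpha> F \<delta> (d j) (\<sigma> j) \<and>
          pairwise (\<lambda>p q. rho_inf (d j) p q \<ge> \<epsilon>) T \<and>
          real (card S) * exp (b / 2 * real (d j)) \<le> real (card T)"
      proof (cases "S = {}")
        case True
        then show ?thesis by (intro exI[of _ "{}"]) simp
      next
        case False
        have fin: "finite \<D>" by (simp add: \<D>_def)
        have "bad ` S \<subseteq> \<D>" using few S(2) by (auto simp: bad_def \<D>_def)
        from pigeonhole_fibre[OF S(1) fin this False]
        obtain D where D: "D \<in> \<D>" "card S \<le> card \<D> * card {\<phi> \<in> S. bad \<phi> = D}" by blast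
        define S' where "S' = {\<phi> \<in> S. bad \<phi> = D}"
        have D1: "D \<subseteq> {1..d j}" "real (card D) \<le> \<gamma> * real (d j)" using D(1) by (auto simp: \<D>_def)
        have S': "finite S'" "S' \<subseteq> S" using S(1) by (auto simp: S'_def)
        have S'X: "S' \<subseteq> {1..d j} \<rightarrow> X" using S'(2) S(2) by (auto simp: sofic_maps_def)
        have core': "{1..d j} - D \<subseteq> core_vertices B (min \<theta> e) (d j) (\<sigma> j) (f \<circ> \<phi>)" if "\<phi> \<in> S'" for \<phi>
          using that by (auto simp: S'_def bad_def)
        have inj_q: "\<And>q. q \<in> Q \<Longrightarrow> inj (\<sigma> j q)" using Q_carrier perm permutes_inj by blast
        obtain V where V: "V \<subseteq> {1..d j} - D"
          "\<forall>v\<in>V. \<forall>w\<in>V. \<forall>q\<in>Q. v \<noteq> w \<longrightarrow> \<sigma> j q v \<noteq> w"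
          "card ({1..d j} - D) \<le> (2 * card Q + 1) * card V"
          by (rule scattered_subset[of "{1..d j} - D" Q "\<sigma> j"])
            (simp, rule finite_Q, erule inj_q, rule that)
        interpret sofic_surgery G X \<alpha> x0 K A C Q \<theta> e P B R "d j" "\<sigma> j" V
        proof unfold_locales
          show "\<one> \<in> B" "R \<subseteq> B" "A \<subseteq> B" "C \<subseteq> B" "Q \<subseteq> B" by (auto simp: B_def)
          show "inv k \<in> R" if "k \<in> A" for k using that by (simp add: R_def)
          show "\<sigma> j q v \<noteq> w" if "v \<in> V" "w \<in> V" "q \<in> Q" "v \<noteq> w" for v w q
            using V(2) that by blast
        qed (rule B R perm; assumption?)+
        obtain T where T: "finite T" "\<forall>p\<in>T. \<exists>\<phi>\<in>S'. \<exists>W\<subseteq>V. transplant (f \<circ> \<phi>) W p"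
          "pairwise (\<lambda>p q. rho_inf (d j) p q \<ge> \<epsilon>) T"
          "real (card S') * (1 + 1 / real M ^ (card E' * card A)) ^ card V \<le> real M ^ card D * real (card T)"
        proof (rule separated_transplants[where f = f and c = c and \<epsilon> = \<epsilon> and S = S' and D = D
              and E' = E' and cls = cls and M = M])
          show "E' \<subseteq> B" by (auto simp: B_def)
          show "S' \<subseteq> {1..d j} \<rightarrow> X" by (rule S'X)
          show "pairwise (\<lambda>p q. rho_inf (d j) p q \<ge> \<epsilon>) S'" by (rule pairwise_subset[OF S(3) S'(2)])
          show "\<exists>k\<in>K. dist (\<alpha> k x0) (\<alpha> k (f y)) > c" if "y \<in> X" for y by (rule missing[OF that])
          show "dist x y < \<epsilon>"
            if "x \<in> X" "y \<in> X" "\<And>s. s \<in> E' \<Longrightarrow> dist (\<alpha> s (f x)) (\<alpha> s (f y)) \<le> c" for x y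
            by (rule decode[OF that])
          show "cls x < M" if "x \<in> X" for x by (rule cls(2)[OF that])
          show "dist x y < \<epsilon>" if "x \<in> X" "y \<in> X" "cls x = cls y" for x y by (rule cls(3)[OF that])
          show "{1..d j} - D \<subseteq> core_vertices B (min \<theta> e) (d j) (\<sigma> j) (f \<circ> \<phi>)" if "\<phi> \<in> S'" for \<phi>
            by (rule core'[OF that])
        qed (rule pos fX scales E' cls(1) S'(1) D1 V(1) | rule that; assumption)+
        have "T \<subseteq> sofic_maps X \<alpha> F \<delta> (d j) (\<sigma> j)"
        proof
          fix p assume "p \<in> T"
          then obtain \<phi> W where \<phi>: "\<phi> \<in> S'" "W \<subseteq> V" "transplant (f \<circ> \<phi>) W p" using T(2) by blast
          have "f \<circ> \<phi> \<in> {1..d j} \<rightarrow> X" using \<phi>(1) S'X fX(1) by fastforce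
          moreover have "real (card D) * \<Delta>\<^sup>2 \<le> real (d j) * \<delta>\<^sup>2 / 2"
          proof -
            have "real (card D) * \<Delta>\<^sup>2 \<le> \<gamma> * real (d j) * \<Delta>\<^sup>2" using D1(2) by (intro mult_right_mono) auto
            also have "\<dots> = real (d j) * (\<gamma> * \<Delta>\<^sup>2)" by simp
            also have "\<dots> \<le> real (d j) * (\<delta>\<^sup>2 / 2)" using \<gamma>\<Delta> by (intro mult_left_mono) auto
            finally show ?thesis by simp
          qed
          moreover have "F \<subseteq> B" "E \<subseteq> B" by (auto simp: B_def)
          ultimately show "p \<in> sofic_maps X \<alpha> F \<delta> (d j) (\<sigma> j)"
            using transplant_sofic_map[OF \<phi>(3) _ pos D1(1) core'[OF \<phi>(1)] _ \<Delta> _ _ window E_sep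
                scales(4) \<open>\<delta> > 0\<close>] by blast
        qed
        moreover have "real (card S) * exp (b / 2 * real (d j)) \<le> real (card T)"
        proof (rule gain_exceeds_losses[where n = "card \<D>" and s' = "real (card S')" and L = L and
              v = "card V" and D = "card D" and q = q and \<gamma> = \<gamma> and \<mu> = \<mu> and M = "real M"])
          show "real (card S) \<le> real (card \<D>) * real (card S')"
            using D(2) by (simp only: S'_def flip: of_nat_mult of_nat_le_iff)
          show "real (card \<D>) \<le> exp (\<mu> * real (d j) + \<gamma> * real (d j) * ln (1 / \<mu>))"
            using card_small_subsets_le[of "{1..d j}" \<mu> "\<gamma> * real (d j)"] rates(4,5) by (simp add: \<D>_def)
          show "(1 - \<gamma>) * real (d j) \<le> real q * real (card V)"
          proof -
            have "card ({1..d j} - D) = d j - card D" using D1(1) by (simp add: card_Diff_subset finite_subset)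
            then have "real (d j) \<le> real (card D) + real (q * card V)"
              using V(3) by (simp only: q_def flip: of_nat_add of_nat_le_iff)
            then show ?thesis using D1(2) by (simp add: algebra_simps)
          qed
        qed (use T(4) D1(2) rates cls(1) L in \<open>auto simp: L_def b_def q_def\<close>)
        ultimately show ?thesis using T(1,3) by blast
      qed
    qed
    then show ?thesis using B \<delta>' by blast
  qed
  then show thesis using b by (intro that[of "b / 2"]) (auto simp: \<epsilon>_def)
qed

end


section \<open>Surjunctivity\<close>

lemma log_enat_less_zero_iff: "log_enat N < 0 \<longleftrightarrow> N = 0"
  by (auto simp: log_enat_def zero_enat_def split: enat.splits)

lemma log_enat_mono: "M \<le> N \<Longrightarrow> log_enat M \<le> log_enat N"
  by (cases M; cases N) (auto simp: log_enat_def)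

lemma card_le_separation_number:
  "finite S \<Longrightarrow> S \<subseteq> A \<Longrightarrow> pairwise (\<lambda>p q. r p q \<ge> \<epsilon>) S \<Longrightarrow> enat (card S) \<le> separation_number \<epsilon> r A"
  unfolding separation_number_def by (rule SUP_upper) simp

lemma separation_number_zero_imp:
  assumes "separation_number \<epsilon> r A = 0" shows "A = {}"
proof (rule ccontr)
  assume "A \<noteq> {}"
  then obtain p where "p \<in> A" by blast
  then have "enat (card {p}) \<le> separation_number \<epsilon> r A"
    by (intro card_le_separation_number) auto
  then show False using assms by (simp add: zero_enat_def)
qed

lemma separation_number_empty: "separation_number \<epsilon> r {} = 0"
proof -
  have "{S. finite S \<and> S \<subseteq> {} \<and> pairwise (\<lambda>p q. \<epsilon> \<le> r p q) S} = {{}}" by auto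
  then show ?thesis by (simp add: separation_number_def zero_enat_def)
qed

lemma separation_number_attained:
  assumes bound: "\<forall>S. S \<subseteq> A \<longrightarrow> pairwise (\<lambda>p q. r p q \<ge> \<epsilon>) S \<longrightarrow> card S \<le> b"
  obtains S where "finite S" "S \<subseteq> A" "pairwise (\<lambda>p q. r p q \<ge> \<epsilon>) S"
    "separation_number \<epsilon> r A = enat (card S)"
proof -
  define \<S> where "\<S> = {S. finite S \<and> S \<subseteq> A \<and> pairwise (\<lambda>p q. r p q \<ge> \<epsilon>) S}"
  have "{} \<in> \<S>" by (simp add: \<S>_def)
  moreover have "\<forall>S. S \<in> \<S> \<longrightarrow> card S < Suc b" using bound by (auto simp: \<S>_def less_Suc_eq_le)
  ultimately obtain S where S: "S \<in> \<S>" "\<And>T. T \<in> \<S> \<Longrightarrow> card T \<le> card S"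
    using ex_has_greatest_nat[of "\<lambda>S. S \<in> \<S>" "{}" card "Suc b"] by metis
  have "separation_number \<epsilon> r A = enat (card S)"
    unfolding separation_number_def \<S>_def[symmetric]
    using S by (intro antisym SUP_least SUP_upper) auto
  moreover have "finite S" "S \<subseteq> A" "pairwise (\<lambda>p q. r p q \<ge> \<epsilon>) S" using S(1) by (simp_all add: \<S>_def)
  ultimately show thesis using that by blast
qed

text \<open>
  The sequence whose upper limit enters the definition of \<open>sofic_entropy\<close>.
\<close>

definition map_growth where
  "map_growth X \<alpha> \<epsilon> d \<sigma> F \<delta> j = ereal (1 / real (d j)) *
    log_enat (separation_number \<epsilon> (rho_inf (d j)) (sofic_maps X \<alpha> F \<delta> (d j) (\<sigma> j)))"

lemma limsup_add_const_le:
  fixes u v :: "nat \<Rightarrow> ereal"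
  assumes "\<forall>\<^sub>F j in sequentially. u j + ereal \<kappa> \<le> v j"
  shows "limsup u + ereal \<kappa> \<le> limsup v"
proof -
  have "limsup u + ereal \<kappa> = limsup (\<lambda>j. u j + ereal \<kappa>)"
    using Limsup_add_ereal_right[of sequentially "ereal \<kappa>" u] by simp
  also have "\<dots> \<le> limsup v" using assms by (rule Limsup_mono)
  finally show ?thesis .
qed

lemma map_growth_le:
  assumes "d j > 0" "M > (0 :: nat)"
    and card: "\<And>S. S \<subseteq> sofic_maps X \<alpha> F \<delta> (d j) (\<sigma> j) \<Longrightarrow>
      pairwise (\<lambda>p q. rho_inf (d j) p q \<ge> \<epsilon>) S \<Longrightarrow> card S \<le> M ^ d j"
  shows "map_growth X \<alpha> \<epsilon> d \<sigma> F \<delta> j \<le> ereal (ln (real M))"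
proof -
  have "separation_number \<epsilon> (rho_inf (d j)) (sofic_maps X \<alpha> F \<delta> (d j) (\<sigma> j)) \<le> enat (M ^ d j)"
    unfolding separation_number_def using card by (intro SUP_least) auto
  then have "log_enat (separation_number \<epsilon> (rho_inf (d j)) (sofic_maps X \<alpha> F \<delta> (d j) (\<sigma> j)))
      \<le> ereal (real (d j) * ln (real M))"
    using log_enat_mono[of _ "enat (M ^ d j)"] assms(2) by (simp add: log_enat_def ln_realpow)
  then have "map_growth X \<alpha> \<epsilon> d \<sigma> F \<delta> j \<le> ereal (1 / real (d j)) * ereal (real (d j) * ln (real M))"
    unfolding map_growth_def by (intro ereal_mult_left_mono) auto
  then show ?thesis using assms(1) by simp
qed

text \<open>
  The entropy is a supremum over all scales, but if the rate is negative at one scale, then there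
  are eventually no maps of precision \<open>(F, \<delta>)\<close> at all, and the rate is \<open>- \<infinity>\<close> at every scale.
\<close>

lemma limsup_map_growth_nonneg:
  assumes h: "sofic_entropy G X \<alpha> d \<sigma> \<ge> 0" and pos: "\<And>j. d j > 0"
    and F: "finite F" "F \<noteq> {}" "F \<subseteq> carrier G" "\<delta> > 0"
  shows "limsup (map_growth X \<alpha> \<epsilon> d \<sigma> F \<delta>) \<ge> 0"
proof (rule ccontr)
  assume "\<not> ?thesis"
  then have "limsup (map_growth X \<alpha> \<epsilon> d \<sigma> F \<delta>) < 0" by simp
  then have "\<forall>\<^sub>F j in sequentially. map_growth X \<alpha> \<epsilon> d \<sigma> F \<delta> j < 0" by (rule Limsup_lessD)
  then have ev: "\<forall>\<^sub>F j in sequentially. map_growth X \<alpha> \<epsilon>' d \<sigma> F \<delta> j = - \<infinity>" for \<epsilon>'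
  proof eventually_elim
    case (elim j)
    then have "log_enat (separation_number \<epsilon> (rho_inf (d j)) (sofic_maps X \<alpha> F \<delta> (d j) (\<sigma> j))) < 0"
      using pos[of j] unfolding map_growth_def by (meson ereal_less_eq(5) ereal_0_le_mult not_le zero_le_divide_1_iff of_nat_0_le_iff)
    then have "sofic_maps X \<alpha> F \<delta> (d j) (\<sigma> j) = {}"
      using separation_number_zero_imp by (simp add: log_enat_less_zero_iff)
    then show ?case using pos[of j]
      by (simp add: map_growth_def separation_number_empty log_enat_def zero_enat_def)
  qed
  have "limsup (map_growth X \<alpha> \<epsilon>' d \<sigma> F \<delta>) = - \<infinity>" for \<epsilon>'
    using ev[of \<epsilon>'] Limsup_eq[OF ev[of \<epsilon>']] by (simp add: Limsup_const)
  then have "(INF F \<in> {F. finite F \<and> F \<noteq> {} \<and> F \<subseteq> carrier G}. INF \<delta> \<in> {0<..}.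
      limsup (map_growth X \<alpha> \<epsilon>' d \<sigma> F \<delta>)) \<le> - \<infinity>" for \<epsilon>'
    using F by (intro INF_lower2[of F] INF_lower2[of \<delta>]) auto
  then have "sofic_entropy G X \<alpha> d \<sigma> \<le> - \<infinity>"
    unfolding sofic_entropy_def map_growth_def by (intro SUP_least) auto
  then show False using h by simp
qed

theorem theorem1p1:
  fixes G :: "('g, 'm) monoid_scheme"
    and X :: "'x :: metric_space set"
    and \<alpha> :: "'g \<Rightarrow> 'x \<Rightarrow> 'x"
  assumes "sofic_group G"
    and "dynamical_system G X \<alpha>"
    and "expansive G X \<alpha>"
    and "weak_specification G X \<alpha>"
    and "strong_topological_Markov G X \<alpha>"
    and "\<exists>d \<sigma>. sofic_approximation G d \<sigma> \<and> sofic_entropy G X \<alpha> d \<sigma> \<ge> 0"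
  shows "surjunctive G X \<alpha>"
  unfolding surjunctive_def
proof (intro allI impI, rule ccontr)
  fix f assume f: "endomorphism G X \<alpha> f" "inj_on f X" and "f ` X \<noteq> X"
  then obtain x0 where x0: "x0 \<in> X" "x0 \<notin> f ` X" by (auto simp: endomorphism_def)
  obtain d \<sigma> where sofic: "sofic_approximation G d \<sigma>" and h: "sofic_entropy G X \<alpha> d \<sigma> \<ge> 0"
    using assms(6) by blast
  have pos: "d j > 0" for j using sofic by (auto simp: sofic_approximation_def)
  interpret dynamical_system G X \<alpha> by (rule assms(2))
  obtain c where c: "c > 0"
    "\<forall>x\<in>X. \<forall>y\<in>X. x \<noteq> y \<longrightarrow> (\<exists>g\<in>carrier G. dist (\<alpha> g x) (\<alpha> g y) > c)"
    using assms(3) unfolding expansive_def by blast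
  define \<epsilon> where "\<epsilon> = c / 4"
  have "\<epsilon> > 0" using c(1) by (simp add: \<epsilon>_def)
  let ?g = "map_growth X \<alpha> \<epsilon> d \<sigma>"
  obtain \<kappa> where \<kappa>: "\<kappa> > 0" and gain: "\<forall>F \<delta>. finite F \<longrightarrow> F \<subseteq> carrier G \<longrightarrow> \<delta> > 0 \<longrightarrow>
    (\<exists>F' \<delta>'. finite F' \<and> F' \<noteq> {} \<and> F' \<subseteq> carrier G \<and> \<delta>' > 0 \<and>
      (\<forall>\<^sub>F j in sequentially. \<forall>S. finite S \<longrightarrow> S \<subseteq> sofic_maps X \<alpha> F' \<delta>' (d j) (\<sigma> j) \<longrightarrow>
        pairwise (\<lambda>p q. rho_inf (d j) p q \<ge> \<epsilon>) S \<longrightarrow>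
        (\<exists>T. finite T \<and> T \<subseteq> sofic_maps X \<alpha> F \<delta> (d j) (\<sigma> j) \<and>
          pairwise (\<lambda>p q. rho_inf (d j) p q \<ge> \<epsilon>) T \<and>
          real (card S) * exp (\<kappa> * real (d j)) \<le> real (card T))))"
    by (rule sofic_maps_count_increases[OF assms(4,5) c f x0 sofic, folded \<epsilon>_def]) (rule that)
  obtain M :: nat and cls where cls: "M > 0" "\<And>x. x \<in> X \<Longrightarrow> cls x < M"
    "\<And>x y. x \<in> X \<Longrightarrow> y \<in> X \<Longrightarrow> cls x = cls y \<Longrightarrow> dist x y < \<epsilon>"
    using compact_finite_partition[OF compact_space \<open>\<epsilon> > 0\<close>] by metis
  have card_le: "card S \<le> M ^ d j" if "S \<subseteq> sofic_maps X \<alpha> F \<delta> (d j) (\<sigma> j)"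
    "pairwise (\<lambda>p q. rho_inf (d j) p q \<ge> \<epsilon>) S" for F \<delta> j S
  proof -
    have "S \<subseteq> {1..d j} \<rightarrow> X" using that(1) by (auto simp: sofic_maps_def)
    then have "finite S \<and> card S \<le> M ^ card {1..d j}"
      by (rule card_separated_le[OF pos _ that(2) cls(2,3)]) auto
    then show ?thesis by simp
  qed
  have growth_le: "?g F \<delta> j \<le> ereal (ln (real M))" for F \<delta> j
    by (rule map_growth_le, rule pos, rule cls(1), rule card_le)
  \<comment> \<open>The precisions \<open>(F, \<delta>)\<close>.\<close>
  define \<G> where "\<G> = {(F, \<delta> :: real). finite F \<and> F \<noteq> {} \<and> F \<subseteq> carrier G \<and> \<delta> > 0}"
  define h where "h = (INF p\<in>\<G>. limsup (?g (fst p) (snd p)))"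
  have step: "\<exists>p'\<in>\<G>. limsup (?g (fst p') (snd p')) + ereal \<kappa> \<le> limsup (?g (fst p) (snd p))"
    if p: "p \<in> \<G>" for p
  proof -
    obtain F \<delta> where F: "p = (F, \<delta>)" "finite F" "F \<subseteq> carrier G" "\<delta> > 0"
      using p by (auto simp: \<G>_def)
    from gain[rule_format, OF F(2-4)]
    obtain F' \<delta>' where F': "finite F'" "F' \<noteq> {}" "F' \<subseteq> carrier G" "\<delta>' > 0"
      and ev: "\<forall>\<^sub>F j in sequentially. \<forall>S. finite S \<longrightarrow> S \<subseteq> sofic_maps X \<alpha> F' \<delta>' (d j) (\<sigma> j) \<longrightarrow>
        pairwise (\<lambda>p q. rho_inf (d j) p q \<ge> \<epsilon>) S \<longrightarrow>
        (\<exists>T. finite T \<and> T \<subseteq> sofic_maps X \<alpha> F \<delta> (d j) (\<sigma> j) \<and>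
          pairwise (\<lambda>p q. rho_inf (d j) p q \<ge> \<epsilon>) T \<and>
          real (card S) * exp (\<kappa> * real (d j)) \<le> real (card T))"
      by (elim exE conjE) (rule that)
    have "\<forall>\<^sub>F j in sequentially. ?g F' \<delta>' j + ereal \<kappa> \<le> ?g F \<delta> j"
      using ev
    proof eventually_elim
      case (elim j)
      have bound: "\<forall>S. S \<subseteq> sofic_maps X \<alpha> F' \<delta>' (d j) (\<sigma> j) \<longrightarrow>
          pairwise (\<lambda>p q. rho_inf (d j) p q \<ge> \<epsilon>) S \<longrightarrow> card S \<le> M ^ d j"
        using card_le by blast
      obtain S where S: "finite S" "S \<subseteq> sofic_maps X \<alpha> F' \<delta>' (d j) (\<sigma> j)"
        "pairwise (\<lambda>p q. rho_inf (d j) p q \<ge> \<epsilon>) S"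
        "separation_number \<epsilon> (rho_inf (d j)) (sofic_maps X \<alpha> F' \<delta>' (d j) (\<sigma> j)) = enat (card S)"
        by (rule separation_number_attained[OF bound]) (rule that)
      show ?case
      proof (cases "card S = 0")
        case True
        then show ?thesis using S(4) pos[of j] by (simp add: map_growth_def log_enat_def)
      next
        case False
        obtain T where T: "finite T" "T \<subseteq> sofic_maps X \<alpha> F \<delta> (d j) (\<sigma> j)"
          "pairwise (\<lambda>p q. rho_inf (d j) p q \<ge> \<epsilon>) T"
          "real (card S) * exp (\<kappa> * real (d j)) \<le> real (card T)"
          using elim[rule_format, OF S(1-3)] by blast
        have "0 < real (card S) * exp (\<kappa> * real (d j))" using False by simp
        then have T0: "real (card T) > 0" using T(4) by linarith
        have "ln (real (card S)) + \<kappa> * real (d j) = ln (real (card S) * exp (\<kappa> * real (d j)))"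
          using False by (simp add: ln_mult)
        also have "\<dots> \<le> ln (real (card T))"
          using T(4) \<open>0 < real (card S) * _\<close> T0 by (simp only: ln_le_cancel_iff)
        finally have "1 / real (d j) * (ln (real (card S)) + \<kappa> * real (d j)) \<le> 1 / real (d j) * ln (real (card T))"
          using pos[of j] by (intro mult_left_mono) auto
        then have "1 / real (d j) * ln (real (card S)) + \<kappa> \<le> 1 / real (d j) * ln (real (card T))"
          using pos[of j] by (simp add: field_simps)
        then have "?g F' \<delta>' j + ereal \<kappa> \<le> ereal (1 / real (d j)) * log_enat (enat (card T))"
          using False T0 S(4) by (simp add: map_growth_def log_enat_def)
        also have "\<dots> \<le> ?g F \<delta> j" unfolding map_growth_def
          using card_le_separation_number[OF T(1-3)] by (intro ereal_mult_left_mono log_enat_mono) auto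
        finally show ?thesis .
      qed
    qed
    then have "limsup (?g F' \<delta>') + ereal \<kappa> \<le> limsup (?g F \<delta>)" by (rule limsup_add_const_le)
    moreover have "(F', \<delta>') \<in> \<G>" using F' by (simp add: \<G>_def)
    ultimately show ?thesis unfolding F(1) by (intro bexI[of _ "(F', \<delta>')"]) auto
  qed
  have "h \<ge> 0" unfolding h_def
  proof (rule INF_greatest)
    fix p assume "p \<in> \<G>"
    then show "0 \<le> limsup (?g (fst p) (snd p))"
      by (intro limsup_map_growth_nonneg[OF h pos]) (simp_all add: \<G>_def case_prod_beta')
  qed
  have "({\<one>\<^bsub>G\<^esub>}, 1) \<in> \<G>" by (simp add: \<G>_def)
  then have "h \<le> limsup (?g {\<one>\<^bsub>G\<^esub>} 1)" unfolding h_def by (intro INF_lower2[of "({\<one>\<^bsub>G\<^esub>}, 1)"]) auto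
  also have "\<dots> \<le> ereal (ln (real M))"
    using growth_le by (intro Limsup_bounded) auto
  finally have "h < h + ereal \<kappa>" using \<open>h \<ge> 0\<close> \<kappa> by (cases h) auto
  then have "(INF p\<in>\<G>. limsup (?g (fst p) (snd p))) < h + ereal \<kappa>" by (simp only: h_def[symmetric])
  then obtain p where p: "p \<in> \<G>" "limsup (?g (fst p) (snd p)) < h + ereal \<kappa>"
    by (auto simp only: INF_less_iff)
  obtain p' where p': "p' \<in> \<G>" "limsup (?g (fst p') (snd p')) + ereal \<kappa> < h + ereal \<kappa>"
    using step[OF p(1)] p(2) by (blast intro: le_less_trans)
  have "h + ereal \<kappa> \<le> limsup (?g (fst p') (snd p')) + ereal \<kappa>"
    unfolding h_def using p'(1) by (intro add_right_mono INF_lower)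
  then show False using p'(2) by simp
qed

end
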